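(* Consider the mean-shift model $y=X\beta^\star+\mu^\star+\varepsilon$ with $X\in\mathbb{R}^{n\times p}$ deterministic with columns of unit Euclidean norm, $\beta^\star\in\mathbb{R}^p$ arbitrary, $\mu^\star\in\mathbb{R}^n$ with $|\mu^\star|_0\le s$ for a positive integer $s$, and $\varepsilon\sim\mathcal N(0,\sigma^2 I_n)$. Let $\lambda_i=\sigma\sqrt{\log(2n/i)}$, $i=1,\dots,n$, let $\rho\ge 2(4+\sqrt2)$, and let $$(\hat\beta,\hat\mu)\in\arg\min_{\beta\in\mathbb{R}^p,\mu\in\mathbb{R}^n}\Big\{\|y-X\beta-\mu\|_2^2+2\rho J_\lambda(\mu)\Big\}.$$ Let $k_1=p/\log 2$ and $s_1=s\log(2en/s)/\log2$, and suppose there are constants $\kappa_1>2\kappa_2>0$ such that for all $(\beta,\mu)\in\mathbb{R}^p\times\mathbb{R}^n$ satisfying $\sum_{j=1}^n\frac{\lambda_j}{\lambda_n}|\mu|_{(j)}\le 5\big(\sqrt{k_1}\|\beta\|_2+\sqrt{s_1}\|\mu\|_2\big)$ one has $$\|X\beta\|_2^2+\|\mu\|_2^2\ge\kappa_1(\|\beta\|_2^2+\|\mu\|_2^2),\qquad |\langle X\beta,\mu\rangle|\le\kappa_2(\|\beta\|_2^2+\|\mu\|_2^2).$$ Let $\kappa=\sqrt{\kappa_1-2\kappa_2}$. Then, with probability at least $1-\frac12(s/2n)^s-e^{-p}$, $$\|\hat\beta-\beta^\star\|_2^2+\|\hat\mu-\mu^\star\|_2^2\le\frac{4\rho^2}{\kappa^4}\sum_{j=1}^s\lambda_j^2+\frac{5\sigma^2}{\kappa^4}p\le\frac{\sigma^2}{\kappa^4}\Big(4\rho^2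 s\log\Big(\frac{2en}{s}\Big)+5p\Big).$$
   Context: For $u\in\mathbb{R}^m$, $|u|_0$ is the number of nonzero entries of $u$, and $|u|_{(1)}\ge\dots\ge|u|_{(m)}$ are the absolute values of its entries sorted in non-increasing order. For a vector $\lambda\in\mathbb{R}^m$ with non-negative non-increasing entries, the sorted-$\ell_1$ norm is $J_\lambda(x)=\sum_{j=1}^m\lambda_j|x|_{(j)}$. *)

theory Defs
  imports "HOL-Probability.Probability"
begin

definition sorted_abs :: "real ^ 'n \<Rightarrow> real list" where
  "sorted_abs u = rev (sorted_list_of_multiset (image_mset (\<lambda>i. \<bar>u $ i\<bar>) (mset_set (UNIV :: 'n set))))"

text \<open>The j-th largest absolute entry, for j = 1 .. m (1-based, as in the paper).\<close>
definition sabs :: "real ^ 'n \<Rightarrow> nat \<Rightarrow> real" where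
  "sabs u j = sorted_abs u ! (j - 1)"

definition l0 :: "real ^ 'n \<Rightarrow> nat" where
  "l0 u = card {i. u $ i \<noteq> 0}"

definition sorted_l1 :: "(nat \<Rightarrow> real) \<Rightarrow> real ^ 'n \<Rightarrow> real" where
  "sorted_l1 lam x = (\<Sum>j=1..CARD('n). lam j * sabs x j)"

end

theory Submission
  imports Defs
begin

text \<open>
  Write \<open>b\<close> and \<open>m\<close> for the errors of \<open>\<beta>\<close> and \<open>\<mu>\<close>. Moving the minimiser towards the truth in
  one block of variables at a time gives
  \<open>\<parallel>X b\<parallel>\<^sup>2 + \<langle>X b, m\<rangle> \<le> \<langle>\<epsilon>, X b\<rangle>\<close> and
  \<open>\<parallel>m\<parallel>\<^sup>2 + \<langle>X b, m\<rangle> \<le> \<langle>\<epsilon>, m\<rangle> + \<rho> (J \<mu>\<^sup>* - J (\<mu>\<^sup>* + m))\<close>.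
  With the stated probability two events hold: the projection of \<open>\<epsilon>\<close> onto the range of \<open>X\<close> has norm at
  most \<open>\<sigma> \<surd>(5p)\<close>, and every set of \<open>k \<ge> s\<close> coordinates of \<open>\<epsilon>\<close> carries energy at most
  \<open>25 k \<lambda>\<^sub>k\<^sup>2\<close>. The second one yields
  \<open>\<langle>\<epsilon>, m\<rangle> + \<rho> (J \<mu>\<^sup>* - J (\<mu>\<^sup>* + m)) \<le> 2 \<rho> \<Lambda> \<parallel>m\<parallel> - \<rho>/2 J m\<close> with
  \<open>\<Lambda>\<^sup>2 = \<lambda>\<^sub>1\<^sup>2 + \<dots> + \<lambda>\<^sub>s\<^sup>2\<close>.

  Unit columns do not bound the operator norm of \<open>X\<close>, so \<open>\<langle>\<epsilon>, X b\<rangle>\<close> is controlled through \<open>\<parallel>X b\<parallel>\<close>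
  rather than \<open>\<parallel>b\<parallel>\<close>. Inside the cone this costs nothing, because testing the restricted eigenvalue
  condition on a single column gives \<open>\<kappa>\<^sub>1 \<le> 1\<close>. Outside the cone the two inequalities force
  \<open>- \<langle>X b, m\<rangle> > \<parallel>m\<parallel>\<^sup>2\<close>, whereas the condition applied to \<open>(r b, m)\<close>, with \<open>r > 1\<close> chosen so that this
  pair lies on the boundary of the cone, gives \<open>\<bar>\<langle>X b, m\<rangle>\<bar> \<le> 2 \<kappa>\<^sub>2 \<parallel>m\<parallel>\<^sup>2 < \<parallel>m\<parallel>\<^sup>2\<close>.
\<close>

section \<open>Order statistics and the sorted-\<open>\<ell>\<^sub>1\<close> norm\<close>

text \<open>Stated for an arbitrary finite set because \<open>extend_enumeration_dominating\<close>
  applies it to the complement of a block of coordinates. Positions start at 1 to agree with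
  \<open>sabs\<close>.\<close>

lemma ex_decreasing_enumeration:
  fixes f :: "'a \<Rightarrow> real"
  assumes "finite R"
  shows "\<exists>\<pi>. bij_betw \<pi> {1..card R} R \<and> antimono_on {1..card R} (f \<circ> \<pi>)"
proof -
  obtain xs where xs: "set xs = R" "distinct xs"
    using finite_distinct_list[OF assms] by blast
  define zs where "zs = sort_key (\<lambda>x. - f x) xs"
  have zs: "set zs = R" "distinct zs" "length zs = card R"
    using xs distinct_card[of xs] by (auto simp: zs_def)
  have srt: "sorted (map (\<lambda>x. - f x) zs)" by (simp add: zs_def)
  have "bij_betw (\<lambda>j. zs ! (j - 1)) {1..card R} R"
  proof (rule bij_betw_trans[of "\<lambda>j. j - 1" _ "{..<length zs}" "(!) zs", unfolded comp_def])
    show "bij_betw (\<lambda>j. j - 1) {1..card R} {..<length zs}"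
      by (rule bij_betwI[of _ _ _ Suc]) (auto simp: zs)
    show "bij_betw ((!) zs) {..<length zs} R"
      using zs by (intro bij_betw_nth) auto
  qed
  moreover have "antimono_on {1..card R} (f \<circ> (\<lambda>j. zs ! (j - 1)))"
  proof (rule monotone_onI)
    fix i j assume ij: "i \<in> {1..card R}" "j \<in> {1..card R}" "i \<le> j"
    then show "(f \<circ> (\<lambda>j. zs ! (j - 1))) j \<le> (f \<circ> (\<lambda>j. zs ! (j - 1))) i"
      using sorted_nth_mono[OF srt, of "i - 1" "j - 1"] zs(3) by auto
  qed
  ultimately show ?thesis by blast
qed

text \<open>A sorted list is determined by its multiset, so every decreasing enumeration yields the
  same list and ties are harmless.\<close>

lemma sorted_abs_eq:
  fixes u :: "real ^ 'n"
  assumes "bij_betw \<pi> {1..CARD('n)} (UNIV :: 'n set)"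
    and "antimono_on {1..CARD('n)} ((\<lambda>i. \<bar>u $ i\<bar>) \<circ> \<pi>)"
  shows "sorted_abs u = map (\<lambda>j. \<bar>u $ \<pi> j\<bar>) [1..<Suc CARD('n)]"
proof -
  let ?xs = "map (\<lambda>j. \<bar>u $ \<pi> j\<bar>) [1..<Suc CARD('n)]"
  have "mset_set (UNIV :: 'n set) = image_mset \<pi> (mset_set {1..CARD('n)})"
    using assms(1) by (metis bij_betw_def image_mset_mset_set)
  moreover have "mset [1..<Suc CARD('n)] = mset_set {1..CARD('n)}"
    by (simp add: atLeastLessThanSuc_atLeastAtMost del: upt_Suc)
  ultimately have m: "image_mset (\<lambda>i. \<bar>u $ i\<bar>) (mset_set UNIV) = mset (rev ?xs)"
    by (simp add: multiset.map_comp comp_def del: upt_Suc)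
  have "sorted (rev ?xs)"
    unfolding sorted_rev_iff_nth_mono
  proof (intro allI impI)
    fix i j assume "i \<le> j" "j < length ?xs"
    then show "?xs ! j \<le> ?xs ! i"
      using monotone_onD[OF assms(2), of "Suc i" "Suc j"] by (simp del: upt_Suc)
  qed
  then show ?thesis
    unfolding sorted_abs_def m sorted_list_of_multiset_mset
    by (simp only: sorted_sort_id rev_rev_ident)
qed

lemma sabs_enumeration:
  fixes u :: "real ^ 'n"
  obtains \<pi> where "bij_betw \<pi> {1..CARD('n)} (UNIV :: 'n set)"
    and "\<And>j. j \<in> {1..CARD('n)} \<Longrightarrow> sabs u j = \<bar>u $ \<pi> j\<bar>"
proof -
  obtain \<pi> where \<pi>: "bij_betw \<pi> {1..CARD('n)} (UNIV :: 'n set)"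
      "antimono_on {1..CARD('n)} ((\<lambda>i. \<bar>u $ i\<bar>) \<circ> \<pi>)"
    using ex_decreasing_enumeration[of "UNIV :: 'n set" "\<lambda>i. \<bar>u $ i\<bar>"] by auto
  have "sabs u j = \<bar>u $ \<pi> j\<bar>" if "j \<in> {1..CARD('n)}" for j
    using that sorted_abs_eq[OF \<pi>] unfolding sabs_def by (auto simp del: upt_Suc)
  then show thesis using \<pi>(1) that by blast
qed

lemma sabs_antimono:
  fixes u :: "real ^ 'n"
  shows "antimono_on {1..CARD('n)} (sabs u)"
proof -
  obtain \<pi> where \<pi>: "bij_betw \<pi> {1..CARD('n)} (UNIV :: 'n set)"
      "antimono_on {1..CARD('n)} ((\<lambda>i. \<bar>u $ i\<bar>) \<circ> \<pi>)"
    using ex_decreasing_enumeration[of "UNIV :: 'n set" "\<lambda>i. \<bar>u $ i\<bar>"] by auto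
  have "sabs u j = \<bar>u $ \<pi> j\<bar>" if "j \<in> {1..CARD('n)}" for j
    using that sorted_abs_eq[OF \<pi>] unfolding sabs_def by (auto simp del: upt_Suc)
  then show ?thesis using \<pi>(2) unfolding monotone_on_def by auto
qed

lemma sabs_nonneg:
  fixes u :: "real ^ 'n"
  assumes "j \<in> {1..CARD('n)}"
  shows "0 \<le> sabs u j"
proof -
  obtain \<pi> where "\<And>j. j \<in> {1..CARD('n)} \<Longrightarrow> sabs u j = \<bar>u $ \<pi> j\<bar>" using sabs_enumeration[of u] by blast
  then show ?thesis using assms by simp
qed

lemma sum_sabs_power2:
  fixes u :: "real ^ 'n"
  shows "(\<Sum>j=1..CARD('n). (sabs u j)\<^sup>2) = (norm u)\<^sup>2"
proof -
  obtain \<pi> where \<pi>: "bij_betw \<pi> {1..CARD('n)} (UNIV :: 'n set)"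
     "\<And>j. j \<in> {1..CARD('n)} \<Longrightarrow> sabs u j = \<bar>u $ \<pi> j\<bar>" using sabs_enumeration[of u] by blast
  have "(\<Sum>j=1..CARD('n). (sabs u j)\<^sup>2) = (\<Sum>j=1..CARD('n). (u $ \<pi> j)\<^sup>2)"
    using \<pi>(2) by (intro sum.cong) auto
  also have "\<dots> = (\<Sum>i\<in>UNIV. (u $ i)\<^sup>2)"
    by (rule sum.reindex_bij_betw[OF \<pi>(1)])
  finally show ?thesis by (simp add: norm_vec_def L2_set_def sum_nonneg)
qed

text \<open>Exchange argument: if \<open>B\<close> holds the \<open>k\<close> top-ranked
  coordinates, then \<open>A - B\<close> and \<open>B - A\<close> have equally many elements, and
  the level \<open>sabs u k\<close> separates the values outside \<open>B\<close> from those
  inside.\<close>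

lemma sum_le_sum_sabs:
  fixes u :: "real ^ 'n"
  assumes "card A = k"
  shows "(\<Sum>i\<in>A. \<bar>u $ i\<bar>) \<le> (\<Sum>j=1..k. sabs u j)"
proof (cases "k = 0")
  case True
  then show ?thesis using assms by simp
next
  case False
  obtain \<pi> where \<pi>: "bij_betw \<pi> {1..CARD('n)} (UNIV :: 'n set)"
     "\<And>j. j \<in> {1..CARD('n)} \<Longrightarrow> sabs u j = \<bar>u $ \<pi> j\<bar>" using sabs_enumeration[of u] by blast
  have k: "k \<le> CARD('n)" using assms card_mono[of UNIV A] by auto
  define B where "B = \<pi> ` {1..k}"
  have inj: "inj_on \<pi> {1..k}" using \<pi>(1) k by (auto simp: bij_betw_def intro: inj_on_subset)
  then have cB: "card B = k" by (simp add: B_def card_image)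
  let ?c = "sabs u k"
  have inB: "?c \<le> \<bar>u $ i\<bar>" if "i \<in> B" for i
    using that k \<pi>(2) False monotone_onD[OF sabs_antimono[of u], of _ k] by (force simp: B_def)
  have outB: "\<bar>u $ i\<bar> \<le> ?c" if i: "i \<notin> B" for i
  proof -
    have "i \<in> \<pi> ` {1..CARD('n)}" using bij_betw_imp_surj_on[OF \<pi>(1)] by simp
    then obtain j where j: "j \<in> {1..CARD('n)}" "i = \<pi> j" by blast
    then have "j > k" using i by (force simp: B_def)
    then show ?thesis using j \<pi>(2)[of j] False monotone_onD[OF sabs_antimono[of u], of k j] by auto
  qed
  have fin: "finite A" "finite B" by auto
  have "card A = card (A \<inter> B) + card (A - B)" "card B = card (B \<inter> A) + card (B - A)"
    by (simp_all add: card_Int_Diff)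
  then have cc: "card (A - B) = card (B - A)" using assms cB by (simp add: inf_commute)
  have "(\<Sum>i\<in>A. \<bar>u $ i\<bar>) = (\<Sum>i\<in>A - B. \<bar>u $ i\<bar>) + (\<Sum>i\<in>A \<inter> B. \<bar>u $ i\<bar>)"
    by (simp add: sum.Int_Diff[OF fin(1), of _ B])
  also have "(\<Sum>i\<in>A - B. \<bar>u $ i\<bar>) \<le> real (card (A - B)) * ?c"
    using outB by (intro sum_bounded_above) auto
  also have "\<dots> \<le> (\<Sum>i\<in>B - A. \<bar>u $ i\<bar>)"
    unfolding cc using inB by (intro sum_bounded_below) auto
  also have "(\<Sum>i\<in>B - A. \<bar>u $ i\<bar>) + (\<Sum>i\<in>A \<inter> B. \<bar>u $ i\<bar>) = (\<Sum>i\<in>B. \<bar>u $ i\<bar>)"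
    by (simp add: sum.Int_Diff[OF fin(2), of _ A] inf_commute)
  also have "\<dots> = (\<Sum>j=1..k. \<bar>u $ \<pi> j\<bar>)"
    unfolding B_def by (simp only: sum.reindex[OF inj] comp_def)
  also have "\<dots> = (\<Sum>j=1..k. sabs u j)"
    using k by (intro sum.cong) (auto simp: \<pi>(2))
  finally show ?thesis by simp
qed

text \<open>Summation by parts: with \<open>D k\<close> the partial sums of \<open>b - a\<close>,
  the right side minus the left side is \<open>c n * D n\<close> plus the sum of
  \<open>(c k - c (Suc k)) * D k\<close>, and every term is non-negative.\<close>

lemma sum_mult_antimono_le:
  fixes c a b :: "nat \<Rightarrow> real"
  assumes "antimono_on {1..n} c" "\<And>j. j \<in> {1..n} \<Longrightarrow> 0 \<le> c j"
    and "\<And>k. k \<le> n \<Longrightarrow> (\<Sum>j=1..k. a j) \<le> (\<Sum>j=1..k. b j)"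
  shows "(\<Sum>j=1..n. c j * a j) \<le> (\<Sum>j=1..n. c j * b j)"
proof -
  let ?d = "\<lambda>k. \<Sum>j=1..k. b j - a j"
  have d: "0 \<le> ?d k" if "k \<le> n" for k using assms(3)[OF that] by (simp add: sum_subtractf)
  \<comment> \<open>The induction keeps the boundary term \<open>c k * ?d k\<close>; passing from
    \<open>c k\<close> to \<open>c (Suc k)\<close> can only lower it because \<open>?d k\<close> is
    non-negative.\<close>
  have "k \<le> n \<Longrightarrow> 1 \<le> k \<Longrightarrow> c k * ?d k \<le> (\<Sum>j=1..k. c j * (b j - a j))" for k
  proof (induction k)
    case (Suc k)
    show ?case
    proof (cases "k = 0")
      case False
      then have "c (Suc k) \<le> c k" using Suc.prems monotone_onD[OF assms(1), of k "Suc k"] by auto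
      then have "c (Suc k) * ?d k \<le> c k * ?d k" using d[of k] Suc.prems by (intro mult_right_mono) auto
      also have "\<dots> \<le> (\<Sum>j=1..k. c j * (b j - a j))" using Suc False by auto
      finally show ?thesis by (simp add: distrib_left)
    qed simp
  qed simp
  from this[of n] have "0 \<le> (\<Sum>j=1..n. c j * (b j - a j))" if "n > 0"
    using that d[of n] assms(2)[of n] by (auto intro: order_trans[OF mult_nonneg_nonneg])
  then show ?thesis by (cases "n = 0") (auto simp: right_diff_distrib sum_subtractf)
qed

text \<open>A rearrangement inequality: prefix sums compare by \<open>sum_le_sum_sabs\<close>, and
  decreasing weights preserve the comparison. With injectivity on \<open>{1..k}\<close> it serves
  full permutations and leading blocks alike.\<close>

lemma sum_perm_le_sorted:
  fixes u :: "real ^ 'n"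
  assumes "antimono_on {1..k} c" "\<And>j. j \<in> {1..k} \<Longrightarrow> 0 \<le> c j"
    and "inj_on \<pi> {1..k}"
  shows "(\<Sum>j=1..k. c j * \<bar>u $ \<pi> j\<bar>) \<le> (\<Sum>j=1..k. c j * sabs u j)"
proof (rule sum_mult_antimono_le[OF assms(1,2)])
  fix l assume "l \<le> k"
  then have inj: "inj_on \<pi> {1..l}" using assms(3) by (auto intro: inj_on_subset)
  have "(\<Sum>j=1..l. \<bar>u $ \<pi> j\<bar>) = (\<Sum>i\<in>\<pi> ` {1..l}. \<bar>u $ i\<bar>)"
    by (simp only: sum.reindex[OF inj] comp_def)
  also have "\<dots> \<le> (\<Sum>j=1..l. sabs u j)"
    using inj by (intro sum_le_sum_sabs) (simp add: card_image)
  finally show "(\<Sum>j=1..l. \<bar>u $ \<pi> j\<bar>) \<le> (\<Sum>j=1..l. sabs u j)" .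
qed

lemma inner_le_sum_sabs:
  fixes u v :: "real ^ 'n"
  shows "inner u v \<le> (\<Sum>j=1..CARD('n). sabs u j * sabs v j)"
proof -
  obtain \<pi> where \<pi>: "bij_betw \<pi> {1..CARD('n)} (UNIV :: 'n set)"
     "\<And>j. j \<in> {1..CARD('n)} \<Longrightarrow> sabs u j = \<bar>u $ \<pi> j\<bar>" using sabs_enumeration[of u] by blast
  have "inner u v \<le> (\<Sum>i\<in>UNIV. \<bar>u $ i\<bar> * \<bar>v $ i\<bar>)"
    unfolding inner_vec_def inner_real_def abs_mult[symmetric] by (intro sum_mono) auto
  also have "\<dots> = (\<Sum>j=1..CARD('n). \<bar>u $ \<pi> j\<bar> * \<bar>v $ \<pi> j\<bar>)"
    by (rule sum.reindex_bij_betw[OF \<pi>(1), symmetric])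
  also have "\<dots> = (\<Sum>j=1..CARD('n). sabs u j * \<bar>v $ \<pi> j\<bar>)"
    using \<pi>(2) by (intro sum.cong) auto
  also have "\<dots> \<le> (\<Sum>j=1..CARD('n). sabs u j * sabs v j)"
    using \<pi>(1) by (intro sum_perm_le_sorted sabs_antimono sabs_nonneg) (auto simp: bij_betw_def)
  finally show ?thesis .
qed

text \<open>For such weights \<open>sorted_l1 c\<close> is a maximum over permutations of weighted
  sums of absolute values. The permutation ranking the convex combination attains its norm and is a
  competitor, not necessarily the best one, for \<open>x\<close> and for \<open>y\<close>.\<close>

lemma sorted_l1_convex:
  fixes x y :: "real ^ 'n"
  assumes "antimono_on {1..CARD('n)} c" "\<And>j. j \<in> {1..CARD('n)} \<Longrightarrow> 0 \<le> c j"
    and "0 \<le> t" "t \<le> 1"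
  shows "sorted_l1 c ((1 - t) *\<^sub>R x + t *\<^sub>R y) \<le> (1 - t) * sorted_l1 c x + t * sorted_l1 c y"
proof -
  let ?z = "(1 - t) *\<^sub>R x + t *\<^sub>R y"
  obtain \<pi> where \<pi>: "bij_betw \<pi> {1..CARD('n)} (UNIV :: 'n set)"
     "\<And>j. j \<in> {1..CARD('n)} \<Longrightarrow> sabs ?z j = \<bar>?z $ \<pi> j\<bar>" using sabs_enumeration[of ?z] by blast
  have inj: "inj_on \<pi> {1..CARD('n)}" using \<pi>(1) by (simp add: bij_betw_def)
  have *: "\<bar>?z $ i\<bar> \<le> (1 - t) * \<bar>x $ i\<bar> + t * \<bar>y $ i\<bar>" for i
    using abs_triangle_ineq[of "(1 - t) * x $ i" "t * y $ i"] assms(3,4) by (simp add: abs_mult)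
  have "sorted_l1 c ?z \<le> (\<Sum>j=1..CARD('n). c j * ((1 - t) * \<bar>x $ \<pi> j\<bar> + t * \<bar>y $ \<pi> j\<bar>))"
    unfolding sorted_l1_def
  proof (rule sum_mono)
    fix j assume j: "j \<in> {1..CARD('n)}"
    show "c j * sabs ?z j \<le> c j * ((1 - t) * \<bar>x $ \<pi> j\<bar> + t * \<bar>y $ \<pi> j\<bar>)"
      unfolding \<pi>(2)[OF j] by (rule mult_left_mono[OF * assms(2)[OF j]])
  qed
  also have "\<dots> = (1 - t) * (\<Sum>j=1..CARD('n). c j * \<bar>x $ \<pi> j\<bar>) + t * (\<Sum>j=1..CARD('n). c j * \<bar>y $ \<pi> j\<bar>)"
    unfolding sum_distrib_left sum.distrib[symmetric] by (intro sum.cong refl) (simp add: algebra_simps)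
  also have "\<dots> \<le> (1 - t) * sorted_l1 c x + t * sorted_l1 c y"
    unfolding sorted_l1_def using assms
    by (intro add_mono mult_left_mono sum_perm_le_sorted inj) auto
  finally show ?thesis .
qed

section \<open>Sparse vectors and increments of the sorted norm\<close>

lemma sabs_eq_0_of_sparse:
  fixes u :: "real ^ 'n"
  assumes "l0 u \<le> s" "s < j" "j \<le> CARD('n)"
  shows "sabs u j = 0"
proof (rule ccontr)
  assume "sabs u j \<noteq> 0"
  obtain \<pi> where \<pi>: "bij_betw \<pi> {1..CARD('n)} (UNIV :: 'n set)"
     "\<And>j. j \<in> {1..CARD('n)} \<Longrightarrow> sabs u j = \<bar>u $ \<pi> j\<bar>" using sabs_enumeration[of u] by blast
  have pos: "0 < sabs u j" using \<open>sabs u j \<noteq> 0\<close> sabs_nonneg[of j u] assms by force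
  have "\<pi> ` {1..j} \<subseteq> {i. u $ i \<noteq> 0}"
  proof clarify
    fix i assume i: "i \<in> {1..j}" "u $ \<pi> i = 0"
    then have "sabs u j \<le> sabs u i" using assms monotone_onD[OF sabs_antimono[of u], of i j] by auto
    then show False using pos i \<pi>(2)[of i] assms by auto
  qed
  then have "card (\<pi> ` {1..j}) \<le> l0 u" unfolding l0_def by (intro card_mono) auto
  moreover have "card (\<pi> ` {1..j}) = j"
    using \<pi>(1) assms by (subst card_image) (auto simp: bij_betw_def intro: inj_on_subset)
  ultimately show False using assms by auto
qed

text \<open>Removing \<open>s\<close> coordinates moves every order statistic by at most \<open>s\<close> places.\<close>
lemma extend_enumeration_dominating:
  fixes u :: "real ^ 'n"
  assumes "bij_betw \<pi> {1..CARD('n)} (UNIV :: 'n set)" "s \<le> CARD('n)"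
  obtains \<tau> where "bij_betw \<tau> {1..CARD('n)} (UNIV :: 'n set)"
    and "\<And>j. j \<in> {1..s} \<Longrightarrow> \<tau> j = \<pi> j"
    and "\<And>j. j \<in> {Suc s..CARD('n)} \<Longrightarrow> sabs u j \<le> \<bar>u $ \<tau> j\<bar>"
proof -
  define T where "T = \<pi> ` {1..s}"
  have injs: "inj_on \<pi> {1..s}" using assms by (auto simp: bij_betw_def intro: inj_on_subset)
  have cT: "card T = s" unfolding T_def using injs by (simp add: card_image)
  have cR: "card (- T) = CARD('n) - s" using cT card_Diff_subset[of T UNIV] unfolding Compl_eq_Diff_UNIV by simp
  \<comment> \<open>\<open>\<phi>\<close> ranks the remaining coordinates among themselves;
    \<open>\<tau>\<close> follows \<open>\<pi>\<close> on the first \<open>s\<close> places and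
    \<open>\<phi>\<close> afterwards.\<close>
  obtain \<phi> where \<phi>: "bij_betw \<phi> {1..CARD('n) - s} (- T)"
      "antimono_on {1..CARD('n) - s} ((\<lambda>i. \<bar>u $ i\<bar>) \<circ> \<phi>)"
    using ex_decreasing_enumeration[of "- T" "\<lambda>i. \<bar>u $ i\<bar>"] cR by auto
  define \<tau> where "\<tau> j = (if j \<le> s then \<pi> j else \<phi> (j - s))" for j
  have b1: "bij_betw \<tau> {1..s} T"
    unfolding T_def using inj_on_imp_bij_betw[OF injs]
    by (rule bij_betw_cong[THEN iffD1, rotated]) (simp add: \<tau>_def)
  have "bij_betw (\<lambda>j. j - s) {Suc s..CARD('n)} {1..CARD('n) - s}"
    by (rule bij_betwI[of _ _ _ "\<lambda>j. j + s"]) auto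
  from bij_betw_trans[OF this \<phi>(1)] have b2: "bij_betw \<tau> {Suc s..CARD('n)} (- T)"
    by (rule bij_betw_cong[THEN iffD1, rotated]) (simp add: \<tau>_def)
  have "bij_betw \<tau> ({1..s} \<union> {Suc s..CARD('n)}) (T \<union> - T)"
    by (rule bij_betw_combine[OF b1 b2]) auto
  moreover have "{1..s} \<union> {Suc s..CARD('n)} = {1..CARD('n)}" using assms(2) by auto
  ultimately have b: "bij_betw \<tau> {1..CARD('n)} (UNIV :: 'n set)" by simp
  moreover have "sabs u j \<le> \<bar>u $ \<tau> j\<bar>" if j: "j \<in> {Suc s..CARD('n)}" for j
  proof (rule ccontr)
    assume "\<not> sabs u j \<le> \<bar>u $ \<tau> j\<bar>"
    then have less: "\<bar>u $ \<tau> j\<bar> < sabs u j" by simp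
    obtain \<theta> where \<theta>: "bij_betw \<theta> {1..CARD('n)} (UNIV :: 'n set)"
       "\<And>j. j \<in> {1..CARD('n)} \<Longrightarrow> sabs u j = \<bar>u $ \<theta> j\<bar>" using sabs_enumeration[of u] by blast
    \<comment> \<open>Pigeonhole: the \<open>j\<close> top-ranked coordinates have size at least
      \<open>sabs u j\<close>, while from place \<open>j > s\<close> on \<open>\<tau>\<close> is
      decreasing and shows only smaller values. They would have to fit into \<open>j - 1\<close>
      places.\<close>
    have "\<theta> ` {1..j} \<subseteq> \<tau> ` {1..<j}"
    proof clarify
      fix i assume i: "i \<in> {1..j}"
      then have ge: "sabs u j \<le> \<bar>u $ \<theta> i\<bar>"
        using j \<theta>(2)[of i] monotone_onD[OF sabs_antimono[of u], of i j] by auto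
      have "\<theta> i \<in> \<tau> ` {1..CARD('n)}" using bij_betw_imp_surj_on[OF b] by simp
      then obtain l where l: "l \<in> {1..CARD('n)}" "\<theta> i = \<tau> l" by blast
      have "l < j"
      proof (rule ccontr)
        assume "\<not> l < j"
        then have "\<bar>u $ \<tau> l\<bar> \<le> \<bar>u $ \<tau> j\<bar>"
          using monotone_onD[OF \<phi>(2), of "j - s" "l - s"] j l by (auto simp: \<tau>_def)
        then show False using ge less l by simp
      qed
      then show "\<theta> i \<in> \<tau> ` {1..<j}" using l by auto
    qed
    then have "card (\<theta> ` {1..j}) \<le> card (\<tau> ` {1..<j})" by (rule card_mono[rotated]) simp
    also have "\<dots> \<le> card {1..<j}" by (rule card_image_le) simp
    finally have "card (\<theta> ` {1..j}) \<le> card {1..<j}" .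
    moreover have "card (\<theta> ` {1..j}) = j"
      using \<theta>(1) j by (subst card_image) (auto simp: bij_betw_def intro: inj_on_subset)
    ultimately show False using j by auto
  qed
  ultimately show thesis using that[of \<tau>] by (auto simp: \<tau>_def)
qed

text \<open>\<open>\<tau>\<close> starts with the \<open>s\<close> top-ranked places of
  \<open>x\<close>, beyond which \<open>x\<close> vanishes. Evaluating \<open>x + m\<close> along
  \<open>\<tau>\<close> bounds its norm from below: the triangle inequality handles the head, and on
  the tail \<open>x + m\<close> agrees with \<open>m\<close>, whose entries along
  \<open>\<tau>\<close> dominate its order statistics.\<close>

lemma sorted_l1_sparse_diff:
  fixes x m :: "real ^ 'n"
  assumes c: "antimono_on {1..CARD('n)} c" "\<And>j. j \<in> {1..CARD('n)} \<Longrightarrow> 0 \<le> c j"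
    and s: "l0 x \<le> s" "s \<le> CARD('n)"
  shows "sorted_l1 c x - sorted_l1 c (x + m)
           \<le> (\<Sum>j=1..s. c j * sabs m j) - (\<Sum>j=Suc s..CARD('n). c j * sabs m j)"
proof -
  obtain \<pi> where \<pi>: "bij_betw \<pi> {1..CARD('n)} (UNIV :: 'n set)"
     "\<And>j. j \<in> {1..CARD('n)} \<Longrightarrow> sabs x j = \<bar>x $ \<pi> j\<bar>" using sabs_enumeration[of x] by blast
  obtain \<tau> where \<tau>: "bij_betw \<tau> {1..CARD('n)} (UNIV :: 'n set)"
    "\<And>j. j \<in> {1..s} \<Longrightarrow> \<tau> j = \<pi> j"
    "\<And>j. j \<in> {Suc s..CARD('n)} \<Longrightarrow> sabs m j \<le> \<bar>m $ \<tau> j\<bar>"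
    using extend_enumeration_dominating[OF \<pi>(1) s(2), of m] by blast
  have split: "(\<Sum>j=1..CARD('n). f j) = (\<Sum>j=1..s. f j) + (\<Sum>j=Suc s..CARD('n). f j)" for f :: "nat \<Rightarrow> real"
    using sum.ub_add_nat[of 1 s f "CARD('n) - s"] s(2) by simp
  have x0: "x $ \<tau> j = 0" if j: "j \<in> {Suc s..CARD('n)}" for j
  proof -
    have "\<tau> j \<in> \<pi> ` {1..CARD('n)}" using bij_betw_imp_surj_on[OF \<pi>(1)] by simp
    then obtain l where l: "l \<in> {1..CARD('n)}" "\<tau> j = \<pi> l" by blast
    have "l > s"
    proof (rule ccontr)
      assume "\<not> l > s"
      then have "\<tau> l = \<tau> j" using \<tau>(2)[of l] l by simp
      then have "l = j" using inj_onD[OF bij_betw_imp_inj_on[OF \<tau>(1)], of l j] l(1) j by simp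
      then show False using j \<open>\<not> l > s\<close> by auto
    qed
    then show ?thesis using \<pi>(2)[OF l(1)] sabs_eq_0_of_sparse[OF s(1), of l] l by simp
  qed
  have "sorted_l1 c x - (\<Sum>j=1..s. c j * sabs m j) + (\<Sum>j=Suc s..CARD('n). c j * sabs m j)
     \<le> (\<Sum>j=1..s. c j * \<bar>x $ \<pi> j\<bar>) - (\<Sum>j=1..s. c j * \<bar>m $ \<pi> j\<bar>) + (\<Sum>j=Suc s..CARD('n). c j * \<bar>m $ \<tau> j\<bar>)"
  proof (intro add_mono diff_mono)
    have "(\<Sum>j=Suc s..CARD('n). c j * sabs x j) = 0"
      using sabs_eq_0_of_sparse[OF s(1)] by (intro sum.neutral) auto
    then show "sorted_l1 c x \<le> (\<Sum>j=1..s. c j * \<bar>x $ \<pi> j\<bar>)"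
      unfolding sorted_l1_def split[of "\<lambda>j. c j * sabs x j"]
      by (simp only: add_0_right) (rule sum_mono, use \<pi>(2) s(2) in simp)
    show "(\<Sum>j=1..s. c j * \<bar>m $ \<pi> j\<bar>) \<le> (\<Sum>j=1..s. c j * sabs m j)"
    proof (rule sum_perm_le_sorted)
      show "antimono_on {1..s} c" by (rule monotone_on_subset[OF c(1)]) (use s(2) in auto)
      show "inj_on \<pi> {1..s}"
        by (rule inj_on_subset[OF bij_betw_imp_inj_on[OF \<pi>(1)]]) (use s(2) in auto)
    qed (use c(2) s(2) in auto)
    show "(\<Sum>j=Suc s..CARD('n). c j * sabs m j) \<le> (\<Sum>j=Suc s..CARD('n). c j * \<bar>m $ \<tau> j\<bar>)"
      using c(2) \<tau>(3) by (intro sum_mono mult_left_mono) auto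
  qed
  also have "\<dots> \<le> (\<Sum>j=1..s. c j * \<bar>(x + m) $ \<tau> j\<bar>) + (\<Sum>j=Suc s..CARD('n). c j * \<bar>(x + m) $ \<tau> j\<bar>)"
  proof (intro add_mono)
    have "c j * \<bar>x $ \<pi> j\<bar> - c j * \<bar>m $ \<pi> j\<bar> \<le> c j * \<bar>(x + m) $ \<tau> j\<bar>" if j: "j \<in> {1..s}" for j
    proof -
      have "c j * (\<bar>x $ \<pi> j\<bar> - \<bar>m $ \<pi> j\<bar>) \<le> c j * \<bar>(x + m) $ \<tau> j\<bar>"
        unfolding \<tau>(2)[OF j] by (rule mult_left_mono) (use c(2)[of j] s(2) j in auto)
      then show ?thesis by (simp only: right_diff_distrib)
    qed
    then show "(\<Sum>j=1..s. c j * \<bar>x $ \<pi> j\<bar>) - (\<Sum>j=1..s. c j * \<bar>m $ \<pi> j\<bar>) \<le> (\<Sum>j=1..s. c j * \<bar>(x + m) $ \<tau> j\<bar>)"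
      unfolding sum_subtractf[symmetric] by (rule sum_mono)
    show "(\<Sum>j=Suc s..CARD('n). c j * \<bar>m $ \<tau> j\<bar>) \<le> (\<Sum>j=Suc s..CARD('n). c j * \<bar>(x + m) $ \<tau> j\<bar>)"
      using x0 by (intro sum_mono) auto
  qed
  also have "\<dots> = (\<Sum>j=1..CARD('n). c j * \<bar>(x + m) $ \<tau> j\<bar>)" by (rule split[symmetric])
  also have "\<dots> \<le> sorted_l1 c (x + m)"
    unfolding sorted_l1_def using c \<tau>(1) by (intro sum_perm_le_sorted) (auto simp: bij_betw_def)
  finally show ?thesis by linarith
qed

section \<open>Gaussian moments\<close>

text \<open>Completing the square turns the integrand into a multiple of the normal density with
  mean \<open>t * \<sigma>\<^sup>2\<close>.\<close>

lemma nn_integral_normal_density_exp_linear: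
  fixes \<sigma> t :: real
  assumes "0 < \<sigma>"
  shows "(\<integral>\<^sup>+x. normal_density 0 \<sigma> x * ennreal (exp (t * x)) \<partial>lborel) = ennreal (exp (t\<^sup>2 * \<sigma>\<^sup>2 / 2))"
proof -
  have eq: "normal_density 0 \<sigma> x * exp (t * x) = exp (t\<^sup>2 * \<sigma>\<^sup>2 / 2) * normal_density (t * \<sigma>\<^sup>2) \<sigma> x" for x
  proof -
    have "- x\<^sup>2 / (2 * \<sigma>\<^sup>2) + t * x = t\<^sup>2 * \<sigma>\<^sup>2 / 2 + - (x - t * \<sigma>\<^sup>2)\<^sup>2 / (2 * \<sigma>\<^sup>2)"
      using assms by (simp add: field_simps power2_eq_square)
    then show ?thesis
      by (simp add: normal_density_def mult_exp_exp)
  qed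
  have "(\<integral>\<^sup>+x. normal_density 0 \<sigma> x * ennreal (exp (t * x)) \<partial>lborel)
      = (\<integral>\<^sup>+x. ennreal (exp (t\<^sup>2 * \<sigma>\<^sup>2 / 2)) * ennreal (normal_density (t * \<sigma>\<^sup>2) \<sigma> x) \<partial>lborel)"
    by (simp add: ennreal_mult[symmetric] eq)
  also have "\<dots> = ennreal (exp (t\<^sup>2 * \<sigma>\<^sup>2 / 2)) * (\<integral>\<^sup>+x. ennreal (normal_density (t * \<sigma>\<^sup>2) \<sigma> x) \<partial>lborel)"
    by (rule nn_integral_cmult) simp
  also have "(\<integral>\<^sup>+x. ennreal (normal_density (t * \<sigma>\<^sup>2) \<sigma> x) \<partial>lborel) = 1"
    using assms by (simp add: nn_integral_eq_integral)
  finally show ?thesis by simp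
qed

text \<open>The exponential factor changes the variance to
  \<open>\<sigma>\<^sup>2 / (1 - 2 * \<theta>)\<close>; the value is the quotient of the normalising
  constants.\<close>

lemma nn_integral_normal_density_exp_square:
  fixes \<sigma> \<theta> :: real
  assumes "0 < \<sigma>" "\<theta> < 1 / 2"
  shows "(\<integral>\<^sup>+x. normal_density 0 \<sigma> x * ennreal (exp (\<theta> * (x / \<sigma>)\<^sup>2)) \<partial>lborel)
         = ennreal (1 / sqrt (1 - 2 * \<theta>))"
proof -
  define \<tau> where "\<tau> = \<sigma> / sqrt (1 - 2 * \<theta>)"
  have \<tau>: "0 < \<tau>" "\<tau>\<^sup>2 = \<sigma>\<^sup>2 / (1 - 2 * \<theta>)" using assms by (auto simp: \<tau>_def power_divide)
  have eq: "normal_density 0 \<sigma> x * exp (\<theta> * (x / \<sigma>)\<^sup>2) = 1 / sqrt (1 - 2 * \<theta>) * normal_density 0 \<tau> x" for x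
  proof -
    have "- x\<^sup>2 / (2 * \<sigma>\<^sup>2) + \<theta> * (x / \<sigma>)\<^sup>2 = - x\<^sup>2 / (2 * \<tau>\<^sup>2)"
      unfolding \<tau>(2) using assms by (simp add: field_simps power_divide)
    moreover have "1 / sqrt (2 * pi * \<sigma>\<^sup>2) = 1 / sqrt (1 - 2 * \<theta>) * (1 / sqrt (2 * pi * \<tau>\<^sup>2))"
      unfolding \<tau>(2) using assms by (simp add: real_sqrt_mult real_sqrt_divide)
    ultimately show ?thesis
      unfolding normal_density_def by (simp add: mult_exp_exp mult.assoc)
  qed
  have "(\<integral>\<^sup>+x. normal_density 0 \<sigma> x * ennreal (exp (\<theta> * (x / \<sigma>)\<^sup>2)) \<partial>lborel)
      = (\<integral>\<^sup>+x. ennreal (1 / sqrt (1 - 2 * \<theta>)) * ennreal (normal_density 0 \<tau> x) \<partial>lborel)"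
    using assms by (intro nn_integral_cong) (simp only: ennreal_mult'[symmetric] ennreal_mult''[symmetric] normal_density_nonneg exp_ge_zero eq)
  also have "\<dots> = ennreal (1 / sqrt (1 - 2 * \<theta>)) * (\<integral>\<^sup>+x. ennreal (normal_density 0 \<tau> x) \<partial>lborel)"
    by (rule nn_integral_cmult) simp
  also have "(\<integral>\<^sup>+x. ennreal (normal_density 0 \<tau> x) \<partial>lborel) = 1"
    using \<tau> by (simp add: nn_integral_eq_integral)
  finally show ?thesis by simp
qed

lemma nn_integral_std_normal_exp_linear:
  "(\<integral>\<^sup>+x. ennreal (exp (t * x)) \<partial>density lborel (normal_density 0 1)) = ennreal (exp (t\<^sup>2 / 2))"
  using nn_integral_normal_density_exp_linear[of 1 t] by (simp add: nn_integral_density)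

lemma nn_integral_std_normal_exp_square:
  "\<theta> < 1 / 2 \<Longrightarrow> (\<integral>\<^sup>+x. ennreal (exp (\<theta> * x\<^sup>2)) \<partial>density lborel (normal_density 0 1)) = ennreal (1 / sqrt (1 - 2 * \<theta>))"
  using nn_integral_normal_density_exp_square[of 1 \<theta>] by (simp add: nn_integral_density)

text \<open>Chernoff bound: Markov's inequality for \<open>exp Z\<close>, with the free exponent
  absorbed into \<open>Z\<close>.\<close>

lemma (in prob_space) prob_ge_le_exp_moment:
  fixes Z :: "'a \<Rightarrow> real"
  assumes [measurable]: "Z \<in> borel_measurable M"
    and "(\<integral>\<^sup>+\<omega>. ennreal (exp (Z \<omega>)) \<partial>M) \<le> ennreal K" "0 \<le> K"
  shows "prob {\<omega> \<in> space M. a \<le> Z \<omega>} \<le> K * exp (- a)"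
proof -
  have "emeasure M {\<omega> \<in> space M. 1 \<le> ennreal (exp (- a)) * ennreal (exp (Z \<omega>))}
      \<le> ennreal (exp (- a)) * (\<integral>\<^sup>+\<omega>. ennreal (exp (Z \<omega>)) * indicator (space M) \<omega> \<partial>M)"
    by (rule nn_integral_Markov_inequality) auto
  also have "(\<integral>\<^sup>+\<omega>. ennreal (exp (Z \<omega>)) * indicator (space M) \<omega> \<partial>M) = (\<integral>\<^sup>+\<omega>. ennreal (exp (Z \<omega>)) \<partial>M)"
    by (intro nn_integral_cong) auto
  also have "ennreal (exp (- a)) * \<dots> \<le> ennreal (exp (- a)) * ennreal K"
    using assms(2) by (rule mult_left_mono) simp
  also have "\<dots> = ennreal (K * exp (- a))" using assms(3) by (simp add: ennreal_mult[symmetric] mult.commute)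
  also have "{\<omega> \<in> space M. 1 \<le> ennreal (exp (- a)) * ennreal (exp (Z \<omega>))} = {\<omega> \<in> space M. a \<le> Z \<omega>}"
    by (auto simp: ennreal_mult[symmetric] mult_exp_exp)
  finally show ?thesis
    using assms(3) by (simp add: emeasure_eq_measure)
qed

section \<open>Exponential moments of the noise vector\<close>

locale gaussian_noise = prob_space M for M :: "'w measure" +
  fixes eps :: "'w \<Rightarrow> real ^ 'n" and sigma :: real
  assumes sigma_pos: "0 < sigma"
    and noise_dist: "distributed M lborel (\<lambda>\<omega>. eps \<omega> $ i) (normal_density 0 sigma)"
    and noise_indep: "indep_vars (\<lambda>_. borel) (\<lambda>i \<omega>. eps \<omega> $ i) UNIV"
begin

lemma eps_measurable [measurable]: "(\<lambda>\<omega>. eps \<omega> $ i) \<in> borel_measurable M"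
  using distributed_measurable[OF noise_dist[of i]] by simp

lemma inner_eps_measurable [measurable]: "(\<lambda>\<omega>. inner u (eps \<omega>)) \<in> borel_measurable M"
  unfolding inner_vec_def by measurable

lemma nn_integral_exp_inner:
  "(\<integral>\<^sup>+\<omega>. ennreal (exp (inner u (eps \<omega>))) \<partial>M) = ennreal (exp (sigma\<^sup>2 * (norm u)\<^sup>2 / 2))"
proof -
  have ind: "indep_vars (\<lambda>_. borel) (\<lambda>i \<omega>. ennreal (exp (u $ i * (eps \<omega> $ i)))) UNIV"
    by (rule indep_vars_compose2[OF noise_indep, of "\<lambda>i x. ennreal (exp (u $ i * x))"]) auto
  have "(\<integral>\<^sup>+\<omega>. ennreal (exp (inner u (eps \<omega>))) \<partial>M) = (\<integral>\<^sup>+\<omega>. (\<Prod>i\<in>UNIV. ennreal (exp (u $ i * (eps \<omega> $ i)))) \<partial>M)"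
    by (simp add: inner_vec_def exp_sum prod_ennreal)
  also have "\<dots> = (\<Prod>i\<in>UNIV. \<integral>\<^sup>+\<omega>. ennreal (exp (u $ i * (eps \<omega> $ i))) \<partial>M)"
    by (rule indep_vars_nn_integral[OF _ ind]) auto
  also have "\<dots> = (\<Prod>i\<in>UNIV. ennreal (exp ((u $ i)\<^sup>2 * sigma\<^sup>2 / 2)))"
    by (intro prod.cong refl, subst distributed_nn_integral[OF noise_dist, symmetric])
       (auto simp: nn_integral_normal_density_exp_linear[OF sigma_pos])
  also have "\<dots> = ennreal (exp (sigma\<^sup>2 * (norm u)\<^sup>2 / 2))"
    by (simp add: prod_ennreal exp_sum[symmetric] norm_vec_def L2_set_def sum_nonneg sum_distrib_left sum_divide_distrib mult.commute)
  finally show ?thesis .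
qed

text \<open>The moment generating function of a chi-square variable with \<open>card T\<close>
  degrees of freedom.\<close>

lemma nn_integral_exp_sum_squares:
  assumes "\<theta> < 1 / 2"
  shows "(\<integral>\<^sup>+\<omega>. ennreal (exp (\<theta> * (\<Sum>i\<in>T. (eps \<omega> $ i / sigma)\<^sup>2))) \<partial>M)
         = ennreal ((1 / sqrt (1 - 2 * \<theta>)) ^ card T)"
proof -
  have ind: "indep_vars (\<lambda>_. borel) (\<lambda>i \<omega>. ennreal (exp (\<theta> * (eps \<omega> $ i / sigma)\<^sup>2))) T"
    by (rule indep_vars_subset[OF indep_vars_compose2[OF noise_indep, of "\<lambda>i x. ennreal (exp (\<theta> * (x / sigma)\<^sup>2))"]]) auto
  have "(\<integral>\<^sup>+\<omega>. ennreal (exp (\<theta> * (\<Sum>i\<in>T. (eps \<omega> $ i / sigma)\<^sup>2))) \<partial>M)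
      = (\<integral>\<^sup>+\<omega>. (\<Prod>i\<in>T. ennreal (exp (\<theta> * (eps \<omega> $ i / sigma)\<^sup>2))) \<partial>M)"
    by (simp add: sum_distrib_left exp_sum prod_ennreal)
  also have "\<dots> = (\<Prod>i\<in>T. \<integral>\<^sup>+\<omega>. ennreal (exp (\<theta> * (eps \<omega> $ i / sigma)\<^sup>2)) \<partial>M)"
    by (rule indep_vars_nn_integral[OF _ ind]) auto
  also have "\<dots> = (\<Prod>i\<in>T. ennreal (1 / sqrt (1 - 2 * \<theta>)))"
    by (intro prod.cong refl, subst distributed_nn_integral[OF noise_dist, symmetric])
       (auto simp: nn_integral_normal_density_exp_square[OF sigma_pos assms])
  also have "\<dots> = ennreal ((1 / sqrt (1 - 2 * \<theta>)) ^ card T)"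
    using assms by (simp add: ennreal_power)
  finally show ?thesis .
qed

text \<open>Linearising the square with an auxiliary standard Gaussian vector \<open>g\<close> indexed by the basis,
  \<open>exp (x\<^sup>2 / 2) = E exp (g x)\<close>, and exchanging the two expectations avoids any appeal to the
  rotation invariance of the noise.\<close>
lemma nn_integral_exp_projection:
  fixes B :: "(real ^ 'n) set"
  assumes "finite B" "pairwise orthogonal B" "\<And>u. u \<in> B \<Longrightarrow> norm u = 1"
    and \<theta>: "0 \<le> \<theta>" "\<theta> < 1 / 2"
  shows "(\<integral>\<^sup>+\<omega>. ennreal (exp (\<theta> * (\<Sum>u\<in>B. (inner u (eps \<omega>) / sigma)\<^sup>2))) \<partial>M)
         = ennreal ((1 / sqrt (1 - 2 * \<theta>)) ^ card B)"
proof -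
  define N :: "real measure" where "N = density lborel (normal_density 0 1)"
  have setsN [measurable_cong]: "sets N = sets borel" by (simp add: N_def)
  interpret N: prob_space N unfolding N_def by (rule prob_space_normal_density) simp
  interpret P: product_prob_space "\<lambda>_::real ^ 'n. N" B by unfold_locales
  interpret PB: finite_product_prob_space "\<lambda>_::real ^ 'n. N" B by unfold_locales (rule assms(1))
  define G where "G = PiM B (\<lambda>_. N)"
  interpret G: prob_space G unfolding G_def by (rule prob_space_PiM) (rule N.prob_space_axioms)
  interpret MG: pair_sigma_finite M G by unfold_locales
  \<comment> \<open>Chosen so that
    \<open>(c * x)\<^sup>2 / 2 = \<theta> * (x / sigma)\<^sup>2\<close>.\<close>
  define c where "c = sqrt (2 * \<theta>) / sigma"
  have c2: "c\<^sup>2 = 2 * \<theta> / sigma\<^sup>2" using \<theta> by (simp add: c_def power_divide)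
  have comp: "(\<lambda>g. g u) \<in> borel_measurable G" if "u \<in> B" for u
  proof -
    have "(\<lambda>g. g u) \<in> measurable G N" unfolding G_def by (rule measurable_component_singleton[OF that])
    then show ?thesis by (simp cong: measurable_cong_sets add: setsN)
  qed
  have lin: "ennreal (exp (\<theta> * (\<Sum>u\<in>B. (x u / sigma)\<^sup>2))) = (\<integral>\<^sup>+g. ennreal (exp (\<Sum>u\<in>B. c * x u * g u)) \<partial>G)" for x
  proof -
    have "(\<integral>\<^sup>+g. ennreal (exp (\<Sum>u\<in>B. c * x u * g u)) \<partial>G) = (\<integral>\<^sup>+g. (\<Prod>u\<in>B. ennreal (exp (c * x u * g u))) \<partial>G)"
      using assms(1) by (simp add: exp_sum prod_ennreal)
    also have "\<dots> = (\<Prod>u\<in>B. \<integral>\<^sup>+y. ennreal (exp (c * x u * y)) \<partial>N)"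
      unfolding G_def by (rule P.product_nn_integral_prod[OF assms(1)]) measurable
    also have "\<dots> = (\<Prod>u\<in>B. ennreal (exp ((c * x u)\<^sup>2 / 2)))"
      by (simp add: N_def nn_integral_std_normal_exp_linear)
    also have "\<dots> = ennreal (exp (\<theta> * (\<Sum>u\<in>B. (x u / sigma)\<^sup>2)))"
      using assms(1) by (simp add: prod_ennreal exp_sum[symmetric] power_mult_distrib c2 sum_distrib_left power_divide)
    finally show ?thesis by simp
  qed
  have "(\<integral>\<^sup>+\<omega>. ennreal (exp (\<theta> * (\<Sum>u\<in>B. (inner u (eps \<omega>) / sigma)\<^sup>2))) \<partial>M)
     = (\<integral>\<^sup>+\<omega>. (\<integral>\<^sup>+g. ennreal (exp (\<Sum>u\<in>B. c * inner u (eps \<omega>) * g u)) \<partial>G) \<partial>M)"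
    by (simp add: lin)
  also have "\<dots> = (\<integral>\<^sup>+g. (\<integral>\<^sup>+\<omega>. ennreal (exp (\<Sum>u\<in>B. c * inner u (eps \<omega>) * g u)) \<partial>M) \<partial>G)"
  proof (rule MG.Fubini'[symmetric])
    have "(\<lambda>z. snd z u) \<in> borel_measurable (M \<Otimes>\<^sub>M G)" if "u \<in> B" for u
      by (rule measurable_compose[OF measurable_snd comp[OF that]])
    moreover have "(\<lambda>z. inner u (eps (fst z))) \<in> borel_measurable (M \<Otimes>\<^sub>M G)" for u
      by (rule measurable_compose[OF measurable_fst inner_eps_measurable])
    ultimately have "(\<lambda>z. \<Sum>u\<in>B. c * inner u (eps (fst z)) * snd z u) \<in> borel_measurable (M \<Otimes>\<^sub>M G)"
      by (intro borel_measurable_sum borel_measurable_times) auto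
    then show "(\<lambda>(\<omega>, g). ennreal (exp (\<Sum>u\<in>B. c * inner u (eps \<omega>) * g u))) \<in> borel_measurable (M \<Otimes>\<^sub>M G)"
      by (simp add: case_prod_beta')
  qed
  \<comment> \<open>For fixed \<open>g\<close> the exponent is linear in the noise, and by
    orthonormality the squared norm of its coefficient vector is a multiple of the sum of the
    \<open>(g u)\<^sup>2\<close>.\<close>
  also have "\<dots> = (\<integral>\<^sup>+g. ennreal (exp (\<theta> * (\<Sum>u\<in>B. (g u)\<^sup>2))) \<partial>G)"
  proof (rule nn_integral_cong)
    fix g :: "real ^ 'n \<Rightarrow> real"
    have "(\<integral>\<^sup>+\<omega>. ennreal (exp (\<Sum>u\<in>B. c * inner u (eps \<omega>) * g u)) \<partial>M)
        = (\<integral>\<^sup>+\<omega>. ennreal (exp (inner (c *\<^sub>R (\<Sum>u\<in>B. g u *\<^sub>R u)) (eps \<omega>))) \<partial>M)"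
      by (simp add: inner_sum_left sum_distrib_left mult_ac)
    also have "\<dots> = ennreal (exp (sigma\<^sup>2 * (c\<^sup>2 * (norm (\<Sum>u\<in>B. g u *\<^sub>R u))\<^sup>2) / 2))"
      unfolding nn_integral_exp_inner by (simp add: power_mult_distrib)
    also have "(norm (\<Sum>u\<in>B. g u *\<^sub>R u))\<^sup>2 = (\<Sum>u\<in>B. (norm (g u *\<^sub>R u))\<^sup>2)"
      using assms(2) by (intro norm_sum_Pythagorean[OF assms(1)]) (auto simp: pairwise_def orthogonal_def)
    also have "\<dots> = (\<Sum>u\<in>B. (g u)\<^sup>2)" using assms(3) by (intro sum.cong) auto
    finally show "(\<integral>\<^sup>+\<omega>. ennreal (exp (\<Sum>u\<in>B. c * inner u (eps \<omega>) * g u)) \<partial>M) = ennreal (exp (\<theta> * (\<Sum>u\<in>B. (g u)\<^sup>2)))"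
      using sigma_pos by (simp add: c2)
  qed
  \<comment> \<open>The noise has been integrated out; what remains factors over the independent
    coordinates of \<open>g\<close>.\<close>
  also have "\<dots> = (\<integral>\<^sup>+g. (\<Prod>u\<in>B. ennreal (exp (\<theta> * (g u)\<^sup>2))) \<partial>G)"
    using assms(1) by (simp add: exp_sum prod_ennreal sum_distrib_left)
  also have "\<dots> = (\<Prod>u\<in>B. \<integral>\<^sup>+y. ennreal (exp (\<theta> * y\<^sup>2)) \<partial>N)"
    unfolding G_def by (rule P.product_nn_integral_prod[OF assms(1)]) measurable
  also have "\<dots> = ennreal ((1 / sqrt (1 - 2 * \<theta>)) ^ card B)"
    unfolding N_def nn_integral_std_normal_exp_square[OF \<theta>(2)] using \<theta> by (simp add: ennreal_power)
  finally show ?thesis .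
qed

end

section \<open>Deviation events\<close>

lemma power_self_le_exp_fact: "real k ^ k \<le> exp (real k) * fact k"
proof -
  \<comment> \<open>A single term of the exponential series is at most its sum.\<close>
  have "(\<Sum>i\<in>{k}. inverse (fact i) * real k ^ i) \<le> (\<Sum>i. inverse (fact i) * real k ^ i)"
    by (rule sum_le_suminf) (auto intro: summable_exp)
  also have "\<dots> = exp (real k)"
    by (simp add: exp_def scaleR_conv_of_real)
  finally show ?thesis by (simp add: field_simps)
qed

text \<open>The familiar estimate of \<open>n choose k\<close> by the \<open>k\<close>-th power of
  \<open>e n / k\<close>, in product form so that \<open>k = 0\<close> is no exception.\<close>

lemma choose_mult_power_le_exp:
  assumes "0 < n"
  shows "real (n choose k) * (real k / real n) ^ k \<le> exp (real k)"
proof -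
  have "real (n choose k) * fact k \<le> real n ^ k"
    using binomial_fact_pow[of n k] by (metis of_nat_fact of_nat_le_iff of_nat_mult of_nat_power)
  then have "real (n choose k) * fact k * real k ^ k \<le> real n ^ k * (exp (real k) * fact k)"
    by (intro mult_mono power_self_le_exp_fact) auto
  then have "(real (n choose k) * real k ^ k) * fact k \<le> (real n ^ k * exp (real k)) * fact k"
    by (simp add: mult_ac)
  then have "real (n choose k) * real k ^ k \<le> real n ^ k * exp (real k)"
    by (rule mult_right_le_imp_le) simp
  then show ?thesis using assms by (simp add: power_divide field_simps)
qed

text \<open>The function \<open>x ln (2n/x)\<close> decreases beyond \<open>x = 2n/e\<close>, so
  monotonicity alone fails and the factor 2 pays for it. After splitting \<open>ln (2n/s)\<close>
  into \<open>ln (2n/k) + ln (k/s)\<close>, each part contributes at most one copy of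
  \<open>k ln (2n/k)\<close>.\<close>

lemma mult_ln_ratio_le_double:
  fixes s k n :: nat
  assumes "0 < s" "s \<le> k" "k \<le> n"
  shows "real s * ln (2 * real n / real s) \<le> 2 * (real k * ln (2 * real n / real k))"
proof -
  have l2: "ln 2 \<le> ln (2 * real n / real k)" using assms by (subst ln_le_cancel_iff) (auto simp: field_simps)
  have l20: "0 < ln (2::real)" "ln (2::real) < 1" "1 / 2 \<le> ln (2::real)"
    using ln_2_less_1 ln2_ge_two_thirds by auto
  \<comment> \<open>The tangent of \<open>ln\<close> at 2, together with
    \<open>1 / 2 \<le> ln 2 < 1\<close>, yields \<open>ln x \<le> x * ln 2\<close> for
    \<open>x = k / s\<close>.\<close>
  have "ln (real k / real s) = ln 2 + ln (real k / real s / 2)" using assms by (simp add: ln_div ln_mult)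
  also have "\<dots> \<le> ln 2 + (real k / real s / 2 - 1)" using assms ln_le_minus_one[of "real k / real s / 2"] by auto
  also have "\<dots> \<le> real k / real s * ln 2"
  proof -
    have "real k / real s * (1 / 2) \<le> real k / real s * ln 2" using l20 by (intro mult_left_mono) auto
    then show ?thesis using l20 by simp
  qed
  finally have "real s * ln (real k / real s) \<le> real s * (real k / real s * ln 2)" by (rule mult_left_mono) simp
  also have "\<dots> \<le> real k * ln (2 * real n / real k)" using assms l2 by (simp add: mult_left_mono)
  finally have 1: "real s * ln (real k / real s) \<le> real k * ln (2 * real n / real k)" .
  have 2: "real s * ln (2 * real n / real k) \<le> real k * ln (2 * real n / real k)"
    using l2 l20 assms by (intro mult_right_mono) auto
  have "ln (2 * real n / real s) = ln (2 * real n / real k) + ln (real k / real s)"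
    using assms by (simp add: ln_div)
  then show ?thesis using 1 2 by (simp add: distrib_left)
qed

lemma exp_neg_mult_ln_ratio:
  fixes k n :: nat
  assumes "0 < k" "0 < n"
  shows "exp (- (real k * ln (2 * real n / real k))) = (real k / (2 * real n)) ^ k"
proof -
  have "- (real k * ln (2 * real n / real k)) = real k * ln (real k / (2 * real n))"
    using assms by (simp add: ln_div algebra_simps)
  then show ?thesis using assms by (simp add: exp_of_nat_mult)
qed

text \<open>One size class of the union bound over coordinate sets. The exponent holds 75/8 copies
  of \<open>k ln (2n/k)\<close>, more than 9 = 1 + 2 + 6: one copy pays for the binomial coefficient
  and \<open>2 ^ k\<close>, two give the power of \<open>s / (2n)\<close>, six give geometric
  decay.\<close>

lemma choose_mult_exp_le_geometric:
  fixes s k n :: nat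
  assumes "0 < s" "s \<le> k" "k \<le> n"
  shows "real (n choose k) * (2 ^ k * exp (- (3 / 8 * (25 * (real k * ln (2 * real n / real k))))))
          \<le> (real s / (2 * real n)) ^ s * (1 / 16) ^ k"
proof -
  let ?L = "real k * ln (2 * real n / real k)"
  let ?r = "real k / (2 * real n)"
  have pos: "0 < k" "0 < n" using assms by auto
  have r: "0 \<le> ?r" "?r \<le> 1 / 2" using assms by (auto simp: field_simps)
  have L0: "0 \<le> ?L" using assms by (intro mult_nonneg_nonneg ln_ge_zero) (auto simp: field_simps)
  have "exp (- (3 / 8 * (25 * ?L))) \<le> exp (- (9 * ?L))" using L0 by simp
  also have "- (9 * ?L) = - ?L + (- (2 * ?L) + - (6 * ?L))" by simp
  also have "exp \<dots> = exp (- ?L) * (exp (- (2 * ?L)) * exp (- (6 * ?L)))" by (simp only: exp_add)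
  also have "exp (- (2 * ?L)) \<le> exp (- (real s * ln (2 * real n / real s)))"
    using mult_ln_ratio_le_double[OF assms] by simp
  also have "exp (- (real s * ln (2 * real n / real s))) = (real s / (2 * real n)) ^ s"
    by (rule exp_neg_mult_ln_ratio) (use assms in auto)
  also have "exp (- (6 * ?L)) = exp (- ?L) ^ 6"
    by (simp add: exp_of_nat_mult[symmetric])
  also have "exp (- ?L) = ?r ^ k" by (rule exp_neg_mult_ln_ratio[OF pos])
  finally have E: "exp (- (3 / 8 * (25 * ?L))) \<le> ?r ^ k * ((real s / (2 * real n)) ^ s * (?r ^ k) ^ 6)"
    by simp
  have r6: "(?r ^ k) ^ 6 \<le> (1 / 64) ^ k"
  proof -
    have "(?r ^ k) ^ 6 = (?r ^ 6) ^ k" by (simp add: power_mult[symmetric] mult.commute)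
    also have "\<dots> \<le> ((1 / 2) ^ 6) ^ k" using r by (intro power_mono) auto
    finally show ?thesis by (simp add: power_divide)
  qed
  have "real (n choose k) * (2 ^ k * exp (- (3 / 8 * (25 * ?L))))
     \<le> real (n choose k) * (2 ^ k * (?r ^ k * ((real s / (2 * real n)) ^ s * (1 / 64) ^ k)))"
    using r r6 by (intro mult_left_mono order_trans[OF E]) auto
  \<comment> \<open>\<open>2 ^ k\<close> times \<open>?r ^ k\<close> is \<open>(k / n) ^ k\<close>,
    the factor that the binomial estimate needs.\<close>
  also have "\<dots> = (real (n choose k) * (real k / real n) ^ k) * ((real s / (2 * real n)) ^ s * (1 / 64) ^ k)"
    by (simp add: power_divide power_mult_distrib)
  also have "\<dots> \<le> exp (real k) * ((real s / (2 * real n)) ^ s * (1 / 64) ^ k)"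
    by (intro mult_right_mono choose_mult_power_le_exp[OF pos(2)]) auto
  also have "exp (real k) = exp 1 ^ k" using exp_of_nat_mult[of k 1] by simp
  also have "exp 1 ^ k * ((real s / (2 * real n)) ^ s * (1 / 64) ^ k) = (real s / (2 * real n)) ^ s * (exp 1 / 64) ^ k"
    by (simp add: power_divide)
  also have "\<dots> \<le> (real s / (2 * real n)) ^ s * (1 / 16) ^ k"
    using exp_le by (intro mult_left_mono power_mono) auto
  finally show ?thesis .
qed

section \<open>The two high-probability events\<close>

context gaussian_noise
begin

text \<open>An orthonormal basis of the range of \<open>X\<close> has at most
  \<open>CARD('p)\<close> elements, so a single chi-square bound, followed by Cauchy-Schwarz,
  controls all \<open>b\<close> at once.\<close>

lemma prob_inner_range_le:
  fixes X :: "real ^ 'p ^ 'n"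
  shows "\<exists>A\<in>events. 1 - exp (- real CARD('p)) \<le> prob A \<and>
           (\<forall>\<omega>\<in>A. \<forall>b. inner (eps \<omega>) (X *v b) \<le> sigma * sqrt (5 * real CARD('p)) * norm (X *v b))"
proof -
  let ?V = "range ((*v) X)" and ?p = "CARD('p)"
  have "subspace ?V" by (intro linear_subspace_image) auto
  then obtain B where B: "B \<subseteq> ?V" "pairwise orthogonal B" "\<And>u. u \<in> B \<Longrightarrow> norm u = 1"
      "independent B" "card B = dim ?V" "span B = ?V"
    using orthonormal_basis_subspace by blast
  have fin: "finite B" by (rule independent_imp_finite[OF B(4)])
  have "dim ?V \<le> dim (UNIV :: (real ^ 'p) set)" by (rule dim_image_le) auto
  then have cB: "card B \<le> ?p" using B(5) by simp
  \<comment> \<open>With exponent 2/5 each basis vector contributes the moment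
    \<open>sqrt 5 \<le> exp 1\<close>, while the threshold \<open>5p\<close> becomes
    \<open>2p\<close>; the net exponent is \<open>p - 2p = - p\<close>.\<close>
  define Z where "Z \<omega> = 2 / 5 * (\<Sum>u\<in>B. (inner u (eps \<omega>) / sigma)\<^sup>2)" for \<omega>
  have Zm [measurable]: "Z \<in> borel_measurable M" unfolding Z_def by measurable
  define A where "A = {\<omega> \<in> space M. Z \<omega> < 2 * real ?p}"
  have A: "A \<in> events" unfolding A_def by measurable
  have "prob {\<omega> \<in> space M. 2 * real ?p \<le> Z \<omega>} \<le> (1 / sqrt (1 - 2 * (2 / 5))) ^ card B * exp (- (2 * real ?p))"
    using nn_integral_exp_projection[OF fin B(2,3), of "2 / 5"]
    by (intro prob_ge_le_exp_moment Zm) (auto simp: Z_def)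
  also have "\<dots> \<le> exp 1 ^ ?p * exp (- (2 * real ?p))"
  proof (intro mult_right_mono)
    \<comment> \<open>The quadratic Taylor bound gives \<open>exp 1 \<ge> 5 / 2\<close>, whose
      square exceeds 5.\<close>
    have "sqrt 5 \<le> exp 1"
    proof (rule real_le_lsqrt)
      have "(5 / 2)\<^sup>2 \<le> (exp 1 :: real)\<^sup>2" using exp_ge_add_one_self exp_lower_Taylor_quadratic[of 1] by (intro power_mono) auto
      then show "(5::real) \<le> (exp 1)\<^sup>2" by (simp add: power2_eq_square)
    qed auto
    then have "(1 / sqrt (1 - 2 * (2 / 5))) ^ card B \<le> exp 1 ^ card B"
      by (intro power_mono) (auto simp: real_sqrt_divide)
    also have "\<dots> \<le> (exp 1 :: real) ^ ?p" using cB by (intro power_increasing) auto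
    finally show "(1 / sqrt (1 - 2 * (2 / 5))) ^ card B \<le> (exp 1 :: real) ^ ?p" .
  qed simp
  also have "\<dots> = exp (- real ?p)"
    unfolding exp_of_nat_mult[symmetric] by (simp add: mult_exp_exp)
  also have "{\<omega> \<in> space M. 2 * real ?p \<le> Z \<omega>} = space M - A" by (auto simp: A_def)
  finally have "1 - exp (- real ?p) \<le> prob A" using prob_compl[OF A] by simp
  moreover have "inner (eps \<omega>) (X *v b) \<le> sigma * sqrt (5 * real ?p) * norm (X *v b)" if "\<omega> \<in> A" for \<omega> b
  proof -
    let ?x = "X *v b"
    have x: "(\<Sum>u\<in>B. inner ?x u *\<^sub>R u) = ?x"
      using B(6) by (intro orthonormal_basis_expand[OF B(2,3) _ fin]) auto
    have "(norm (\<Sum>u\<in>B. inner ?x u *\<^sub>R u))\<^sup>2 = (\<Sum>u\<in>B. (norm (inner ?x u *\<^sub>R u))\<^sup>2)"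
      using B(2) by (intro norm_sum_Pythagorean[OF fin]) (auto simp: pairwise_def orthogonal_def)
    also have "\<dots> = (\<Sum>u\<in>B. (inner ?x u)\<^sup>2)" using B(3) by (intro sum.cong) auto
    finally have nx: "L2_set (inner ?x) B = norm ?x" unfolding x L2_set_def by (metis norm_ge_zero real_sqrt_unique)
    have "Z \<omega> = 2 / 5 * ((\<Sum>u\<in>B. (inner u (eps \<omega>))\<^sup>2) / sigma\<^sup>2)"
      by (simp add: Z_def power_divide sum_divide_distrib)
    then have "(\<Sum>u\<in>B. (inner u (eps \<omega>))\<^sup>2) / sigma\<^sup>2 \<le> 5 * real ?p"
      using that by (simp add: A_def)
    then have "(\<Sum>u\<in>B. (inner u (eps \<omega>))\<^sup>2) \<le> 5 * real ?p * sigma\<^sup>2"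
      using sigma_pos by (simp add: pos_divide_le_eq)
    then have "L2_set (\<lambda>u. inner u (eps \<omega>)) B \<le> sqrt (5 * real ?p * sigma\<^sup>2)"
      unfolding L2_set_def by simp
    also have "\<dots> = sigma * sqrt (5 * real ?p)" using sigma_pos by (simp add: real_sqrt_mult)
    finally have ne: "L2_set (\<lambda>u. inner u (eps \<omega>)) B \<le> sigma * sqrt (5 * real ?p)" .
    have "inner (eps \<omega>) ?x = inner (eps \<omega>) (\<Sum>u\<in>B. inner ?x u *\<^sub>R u)" by (simp add: x)
    also have "\<dots> = (\<Sum>u\<in>B. inner u (eps \<omega>) * inner ?x u)"
      by (simp add: inner_sum_right inner_commute mult.commute)
    also have "\<dots> \<le> (\<Sum>u\<in>B. \<bar>inner u (eps \<omega>)\<bar> * \<bar>inner ?x u\<bar>)"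
      unfolding abs_mult[symmetric] by (intro sum_mono) auto
    also have "\<dots> \<le> L2_set (\<lambda>u. inner u (eps \<omega>)) B * L2_set (inner ?x) B"
      by (rule L2_set_mult_ineq)
    also have "\<dots> \<le> sigma * sqrt (5 * real ?p) * norm ?x"
      unfolding nx by (intro mult_right_mono ne) auto
    finally show ?thesis .
  qed
  ultimately show ?thesis using A by blast
qed

text \<open>A union bound over all coordinate sets of size at least \<open>s\<close>, so that the
  estimate also covers the random set of the largest noise entries.\<close>

lemma prob_sum_squares_le:
  assumes s: "0 < s" "s \<le> CARD('n)"
  shows "\<exists>A\<in>events. 1 - 1 / 2 * (real s / (2 * real CARD('n))) ^ s \<le> prob A \<and>
           (\<forall>\<omega>\<in>A. \<forall>T. s \<le> card T \<longrightarrow>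
              (\<Sum>i\<in>T. (eps \<omega> $ i)\<^sup>2) \<le> 25 * (sigma\<^sup>2 * (real (card T) * ln (2 * real CARD('n) / real (card T)))))"
proof -
  let ?n = "CARD('n)"
  define L where "L k = real k * ln (2 * real ?n / real k)" for k
  define Z where "Z T \<omega> = 3 / 8 * (\<Sum>i\<in>T. (eps \<omega> $ i / sigma)\<^sup>2)" for T \<omega>
  have Zm [measurable]: "Z T \<in> borel_measurable M" for T unfolding Z_def by measurable
  define F where "F = {T :: 'n set. s \<le> card T}"
  define bad where "bad T = {\<omega> \<in> space M. 3 / 8 * (25 * L (card T)) \<le> Z T \<omega>}" for T
  have badm [measurable]: "bad T \<in> events" for T unfolding bad_def by measurable
  define A where "A = space M - (\<Union>T\<in>F. bad T)"
  have Um: "(\<Union>T\<in>F. bad T) \<in> events" by (intro sets.finite_UN) auto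
  then have A: "A \<in> events" by (simp add: A_def)
  define q where "q k = 2 ^ k * exp (- (3 / 8 * (25 * L k)))" for k
  have badq: "prob (bad T) \<le> q (card T)" for T
  proof -
    \<comment> \<open>Exponent 3/8 makes the moment exactly 2 per coordinate, whence the factor
      \<open>2 ^ k\<close> in \<open>q\<close>.\<close>
    have "1 / sqrt (1 - 2 * (3 / 8)) = (2::real)" by (simp add: real_sqrt_divide)
    then show ?thesis unfolding bad_def q_def
      using nn_integral_exp_sum_squares[of "3 / 8" T] by (intro prob_ge_le_exp_moment Zm) (auto simp: Z_def)
  qed
  have "prob (\<Union>T\<in>F. bad T) \<le> (\<Sum>T\<in>F. prob (bad T))"
    by (rule finite_measure_subadditive_finite) auto
  also have "\<dots> \<le> (\<Sum>T\<in>F. q (card T))" by (intro sum_mono badq)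
  also have "\<dots> = (\<Sum>k=s..?n. \<Sum>T\<in>{T \<in> F. card T = k}. q (card T))"
    by (rule sum.group[symmetric]) (auto simp: F_def card_mono)
  also have "\<dots> = (\<Sum>k=s..?n. real (?n choose k) * q k)"
  proof (rule sum.cong[OF refl])
    fix k assume k: "k \<in> {s..?n}"
    then have "{T \<in> F. card T = k} = {T. T \<subseteq> UNIV \<and> card T = k}" by (auto simp: F_def)
    then have "card {T \<in> F. card T = k} = ?n choose k" using n_subsets[of "UNIV :: 'n set" k] by simp
    then show "(\<Sum>T\<in>{T \<in> F. card T = k}. q (card T)) = real (?n choose k) * q k" by simp
  qed
  also have "\<dots> \<le> (\<Sum>k=s..?n. (real s / (2 * real ?n)) ^ s * (1 / 16) ^ k)"
    unfolding q_def L_def using s by (intro sum_mono choose_mult_exp_le_geometric) auto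
  also have "\<dots> = (real s / (2 * real ?n)) ^ s * (\<Sum>k=s..?n. (1 / 16) ^ k)"
    by (simp add: sum_distrib_left)
  \<comment> \<open>Since \<open>s\<close> is positive the term \<open>k = 0\<close> is absent, and
    the remaining geometric series is at most 1/15.\<close>
  also have "(\<Sum>k=s..?n. (1 / 16 :: real) ^ k) \<le> (\<Sum>k=1..?n. (1 / 16) ^ k)"
    using s by (intro sum_mono2) auto
  also have "\<dots> \<le> 1 / 2"
    by (subst sum_gp) (auto simp: field_simps)
  finally have "prob (\<Union>T\<in>F. bad T) \<le> 1 / 2 * (real s / (2 * real ?n)) ^ s"
    by (simp add: mult_left_mono)
  then have "1 - 1 / 2 * (real s / (2 * real ?n)) ^ s \<le> prob A"
    unfolding A_def using prob_compl[OF Um] by simp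
  moreover have "(\<Sum>i\<in>T. (eps \<omega> $ i)\<^sup>2) \<le> 25 * (sigma\<^sup>2 * L (card T))" if "\<omega> \<in> A" "s \<le> card T" for \<omega> T
  proof -
    have "\<omega> \<notin> bad T" "\<omega> \<in> space M" using that by (auto simp: A_def F_def)
    then have "Z T \<omega> \<le> 3 / 8 * (25 * L (card T))" by (simp add: bad_def)
    moreover have "Z T \<omega> = 3 / 8 * ((\<Sum>i\<in>T. (eps \<omega> $ i)\<^sup>2) / sigma\<^sup>2)"
      by (simp add: Z_def power_divide sum_divide_distrib)
    ultimately show ?thesis using sigma_pos by (simp add: field_simps)
  qed
  ultimately show ?thesis using A unfolding L_def by blast
qed

end

section \<open>Deterministic analysis\<close>

lemma sum_sabs_power2_le_norm:
  fixes u :: "real ^ 'n"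
  assumes "k \<le> CARD('n)"
  shows "(\<Sum>j=1..k. (sabs u j)\<^sup>2) \<le> (norm u)\<^sup>2"
  unfolding sum_sabs_power2[symmetric] using assms by (intro sum_mono2) auto

lemma sum_mult_sabs_le_L2:
  fixes u :: "real ^ 'n"
  assumes "k \<le> CARD('n)"
  shows "(\<Sum>j=1..k. c j * sabs u j) \<le> sqrt (\<Sum>j=1..k. (c j)\<^sup>2) * norm u"
proof -
  have "(\<Sum>j=1..k. c j * sabs u j) \<le> (\<Sum>j=1..k. \<bar>c j\<bar> * \<bar>sabs u j\<bar>)"
    unfolding abs_mult[symmetric] by (intro sum_mono) auto
  also have "\<dots> \<le> L2_set c {1..k} * L2_set (sabs u) {1..k}" by (rule L2_set_mult_ineq)
  also have "\<dots> \<le> L2_set c {1..k} * norm u"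
    using sum_sabs_power2_le_norm[OF assms, of u]
    by (intro mult_left_mono) (auto simp: L2_set_def real_le_lsqrt sum_nonneg)
  finally show ?thesis by (simp add: L2_set_def)
qed

text \<open>Both vectors are ranked. On the first \<open>s\<close> ranks Cauchy-Schwarz uses the
  energy of the \<open>s\<close> largest entries of \<open>e\<close>, with
  \<open>s * (c s)\<^sup>2\<close> at most the sum of the \<open>(c j)\<^sup>2\<close>; beyond rank
  \<open>s\<close> each entry of \<open>e\<close> is bounded by itself.\<close>

lemma inner_le_of_subset_energy:
  fixes e m :: "real ^ 'n"
  assumes c: "antimono_on {1..CARD('n)} c" "\<And>j. j \<in> {1..CARD('n)} \<Longrightarrow> 0 \<le> c j"
    and s: "0 < s" "s \<le> CARD('n)" and "0 \<le> K"
    and energy: "\<And>T. s \<le> card T \<Longrightarrow> (\<Sum>i\<in>T. (e $ i)\<^sup>2) \<le> K\<^sup>2 * (real (card T) * (c (card T))\<^sup>2)"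
  shows "inner e m \<le> K * (sqrt (\<Sum>j=1..s. (c j)\<^sup>2) * norm m) + K * (\<Sum>j=Suc s..CARD('n). c j * sabs m j)"
proof -
  obtain \<pi> where \<pi>: "bij_betw \<pi> {1..CARD('n)} (UNIV :: 'n set)"
     "\<And>j. j \<in> {1..CARD('n)} \<Longrightarrow> sabs e j = \<bar>e $ \<pi> j\<bar>" using sabs_enumeration[of e] by blast
  have top: "(\<Sum>j=1..k. (sabs e j)\<^sup>2) \<le> K\<^sup>2 * (real k * (c k)\<^sup>2)" if k: "s \<le> k" "k \<le> CARD('n)" for k
  proof -
    have inj: "inj_on \<pi> {1..k}"
      by (rule inj_on_subset[OF bij_betw_imp_inj_on[OF \<pi>(1)]]) (use k in auto)
    have "(\<Sum>j=1..k. (sabs e j)\<^sup>2) = (\<Sum>j=1..k. (e $ \<pi> j)\<^sup>2)" using \<pi>(2) k by (intro sum.cong) auto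
    also have "\<dots> = (\<Sum>i\<in>\<pi> ` {1..k}. (e $ i)\<^sup>2)" by (simp only: sum.reindex[OF inj] comp_def)
    also have "\<dots> \<le> K\<^sup>2 * (real k * (c k)\<^sup>2)"
      using energy[of "\<pi> ` {1..k}"] k card_image[OF inj] by simp
    finally show ?thesis .
  qed
  \<comment> \<open>The \<open>k\<close>-th largest square is at most the average of the
    \<open>k\<close> largest squares.\<close>
  have single: "sabs e k \<le> K * c k" if k: "k \<in> {Suc s..CARD('n)}" for k
  proof -
    have "real (card {1..k}) * (sabs e k)\<^sup>2 \<le> (\<Sum>j=1..k. (sabs e j)\<^sup>2)"
    proof (rule sum_bounded_below)
      fix j assume "j \<in> {1..k}"
      then show "(sabs e k)\<^sup>2 \<le> (sabs e j)\<^sup>2"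
        using k by (intro power_mono monotone_onD[OF sabs_antimono[of e]] sabs_nonneg) auto
    qed
    also have "\<dots> \<le> K\<^sup>2 * (real k * (c k)\<^sup>2)" using k by (intro top) auto
    finally have "real k * (sabs e k)\<^sup>2 \<le> real k * (K * c k)\<^sup>2" by (simp add: power_mult_distrib mult_ac)
    then have "(sabs e k)\<^sup>2 \<le> (K * c k)\<^sup>2" using k by simp
    then show ?thesis by (rule power2_le_imp_le) (use \<open>0 \<le> K\<close> c(2)[of k] k in auto)
  qed
  have split: "(\<Sum>j=1..CARD('n). f j) = (\<Sum>j=1..s. f j) + (\<Sum>j=Suc s..CARD('n). f j)" for f :: "nat \<Rightarrow> real"
    using sum.ub_add_nat[of 1 s f "CARD('n) - s"] s(2) by simp
  have "real (card {1..s}) * (c s)\<^sup>2 \<le> (\<Sum>j=1..s. (c j)\<^sup>2)"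
  proof (rule sum_bounded_below)
    fix j assume "j \<in> {1..s}"
    then show "(c s)\<^sup>2 \<le> (c j)\<^sup>2" using s by (intro power_mono monotone_onD[OF c(1)] c(2)) auto
  qed
  then have "K\<^sup>2 * (real s * (c s)\<^sup>2) \<le> K\<^sup>2 * (\<Sum>j=1..s. (c j)\<^sup>2)" by (simp add: mult_left_mono)
  with top[of s] s have "sqrt (\<Sum>j=1..s. (sabs e j)\<^sup>2) \<le> sqrt (K\<^sup>2 * (\<Sum>j=1..s. (c j)\<^sup>2))"
    by (intro real_sqrt_le_mono) auto
  also have "\<dots> = K * sqrt (\<Sum>j=1..s. (c j)\<^sup>2)" using \<open>0 \<le> K\<close> by (simp add: real_sqrt_mult)
  finally have head: "sqrt (\<Sum>j=1..s. (sabs e j)\<^sup>2) \<le> K * sqrt (\<Sum>j=1..s. (c j)\<^sup>2)" .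
  have "inner e m \<le> (\<Sum>j=1..CARD('n). sabs e j * sabs m j)" by (rule inner_le_sum_sabs)
  also have "\<dots> = (\<Sum>j=1..s. sabs e j * sabs m j) + (\<Sum>j=Suc s..CARD('n). sabs e j * sabs m j)" by (rule split)
  also have "\<dots> \<le> sqrt (\<Sum>j=1..s. (sabs e j)\<^sup>2) * norm m + (\<Sum>j=Suc s..CARD('n). (K * c j) * sabs m j)"
    using single s by (intro add_mono sum_mult_sabs_le_L2 sum_mono mult_right_mono sabs_nonneg) auto
  also have "\<dots> \<le> (K * sqrt (\<Sum>j=1..s. (c j)\<^sup>2)) * norm m + (\<Sum>j=Suc s..CARD('n). (K * c j) * sabs m j)"
    by (intro add_mono mult_right_mono head) auto
  finally show ?thesis by (simp add: sum_distrib_left mult.assoc)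
qed

section \<open>First-order condition and scalar inequalities for the errors\<close>

lemma le_zero_of_le_all_multiples:
  fixes a c :: real
  assumes "\<And>t. 0 < t \<Longrightarrow> t \<le> 1 \<Longrightarrow> a \<le> t * c"
  shows "a \<le> 0"
proof (rule ccontr)
  assume "\<not> a \<le> 0"
  then have a: "0 < a" by simp
  moreover have "a \<le> c" using assms[of 1] by simp
  ultimately have c: "0 < c" by simp
  \<comment> \<open>This \<open>t\<close> is admissible because \<open>a \<le> c\<close>, and it
    would give \<open>a \<le> a / 2\<close>.\<close>
  then show False using assms[of "a / (2 * c)"] a \<open>a \<le> c\<close> by (simp add: field_simps)
qed

text \<open>Convexity along the segment from the minimiser to \<open>(b', m')\<close>, division by
  the step length, and a limit. The end point is free, so \<open>b' = bh\<close> or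
  \<open>m' = mh\<close> holds one block fixed.\<close>

lemma slope_first_order:
  fixes X :: "real ^ 'p ^ 'n" and y mh m' :: "real ^ 'n"
  assumes c: "antimono_on {1..CARD('n)} c" "\<And>j. j \<in> {1..CARD('n)} \<Longrightarrow> 0 \<le> c j"
    and "0 \<le> rho"
    and opt: "\<And>b m. (norm (y - X *v bh - mh))\<^sup>2 + 2 * rho * sorted_l1 c mh
                      \<le> (norm (y - X *v b - m))\<^sup>2 + 2 * rho * sorted_l1 c m"
  shows "- inner (y - X *v bh - mh) (X *v (bh - b') + (mh - m')) \<le> rho * (sorted_l1 c m' - sorted_l1 c mh)"
proof -
  define r where "r = y - X *v bh - mh"
  define v where "v = X *v (bh - b') + (mh - m')"
  let ?J = "sorted_l1 c"
  have "- 2 * inner r v - 2 * rho * (?J m' - ?J mh) \<le> t * (norm v)\<^sup>2" if t: "0 < t" "t \<le> 1" for t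
  proof -
    have eq: "y - X *v ((1 - t) *\<^sub>R bh + t *\<^sub>R b') - ((1 - t) *\<^sub>R mh + t *\<^sub>R m') = r + t *\<^sub>R v"
      by (simp add: r_def v_def matrix_vector_right_distrib matrix_vector_mult_diff_distrib
          matrix_vector_mult_scaleR algebra_simps)
    have "(norm r)\<^sup>2 + 2 * rho * ?J mh
        \<le> (norm (r + t *\<^sub>R v))\<^sup>2 + 2 * rho * ?J ((1 - t) *\<^sub>R mh + t *\<^sub>R m')"
      using opt[of "(1 - t) *\<^sub>R bh + t *\<^sub>R b'" "(1 - t) *\<^sub>R mh + t *\<^sub>R m'"]
      by (simp only: eq r_def[symmetric])
    also have "\<dots> \<le> (norm (r + t *\<^sub>R v))\<^sup>2 + 2 * rho * ((1 - t) * ?J mh + t * ?J m')"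
      using \<open>0 \<le> rho\<close> t by (intro add_left_mono mult_left_mono sorted_l1_convex c) auto
    also have "(norm (r + t *\<^sub>R v))\<^sup>2 = (norm r)\<^sup>2 + 2 * t * inner r v + t\<^sup>2 * (norm v)\<^sup>2"
      unfolding power2_norm_eq_inner by (simp add: inner_add_left inner_add_right inner_commute power2_eq_square)
    finally have "t * (- 2 * inner r v - 2 * rho * (?J m' - ?J mh)) \<le> t * (t * (norm v)\<^sup>2)"
      by (simp add: algebra_simps power2_eq_square)
    then show ?thesis using t by simp
  qed
  then have "- 2 * inner r v - 2 * rho * (?J m' - ?J mh) \<le> 0" by (rule le_zero_of_le_all_multiples)
  then show ?thesis by (simp add: r_def v_def)
qed

text \<open>Here \<open>a\<close>, \<open>w\<close>, \<open>N\<close>, \<open>q\<close> stand for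
  the norms of \<open>b\<close>, \<open>m\<close>, \<open>X b\<close> and for the inner product of
  \<open>X b\<close> with \<open>m\<close>. The cross term uses up at most the fraction
  \<open>2 * k2 / k1\<close> of \<open>N\<^sup>2 + w\<^sup>2\<close>; Cauchy-Schwarz on the right
  side then bounds this energy, and \<open>lower\<close> returns to the errors.\<close>

lemma error_bound_on_cone:
  fixes a w N q P L k1 k2 :: real
  assumes I: "w\<^sup>2 + N\<^sup>2 + 2 * q \<le> P * N + L * w"
    and lower: "k1 * (a\<^sup>2 + w\<^sup>2) \<le> N\<^sup>2 + w\<^sup>2" and cross: "\<bar>q\<bar> \<le> k2 * (a\<^sup>2 + w\<^sup>2)"
    and k: "2 * k2 < k1" "0 < k2" "k1 \<le> 1"
  shows "a\<^sup>2 + w\<^sup>2 \<le> (L\<^sup>2 + P\<^sup>2) / (k1 - 2 * k2)\<^sup>2"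
proof -
  define E where "E = N\<^sup>2 + w\<^sup>2"
  define D where "D = a\<^sup>2 + w\<^sup>2"
  define d where "d = k1 - 2 * k2"
  have d: "0 < d" and k1: "0 < k1" using k by (auto simp: d_def)
  have E0: "0 \<le> E" and D0: "0 \<le> D" by (auto simp: E_def D_def)
  have DE: "k1 * D \<le> E" using lower by (simp add: E_def D_def)
  have "(P * N + L * w)\<^sup>2 \<le> (L\<^sup>2 + P\<^sup>2) * E"
  proof -
    \<comment> \<open>Lagrange's identity, which is Cauchy-Schwarz in the plane.\<close>
    have "(L\<^sup>2 + P\<^sup>2) * E - (P * N + L * w)\<^sup>2 = (P * w - L * N)\<^sup>2"
      by (simp add: E_def power2_eq_square algebra_simps)
    then show ?thesis by (metis diff_ge_0_iff_ge zero_le_power2)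
  qed
  moreover have "d * E \<le> k1 * (P * N + L * w)"
  proof -
    have "k1 * (- 2 * q) \<le> k1 * (2 * (k2 * D))" using cross k1 by (intro mult_left_mono) (auto simp: D_def)
    also have "\<dots> = 2 * k2 * (k1 * D)" by simp
    also have "\<dots> \<le> 2 * k2 * E" using DE k by (intro mult_left_mono) auto
    finally have "d * E \<le> k1 * (E + 2 * q)" by (simp add: d_def algebra_simps)
    also have "\<dots> \<le> k1 * (P * N + L * w)" using I k1 by (intro mult_left_mono) (auto simp: E_def)
    finally show ?thesis .
  qed
  then have "(d * E)\<^sup>2 \<le> (k1 * (P * N + L * w))\<^sup>2" using d E0 by (intro power_mono) auto
  ultimately have "(d * E)\<^sup>2 \<le> k1\<^sup>2 * ((L\<^sup>2 + P\<^sup>2) * E)"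
    by (smt (verit) mult_left_mono power_mult_distrib zero_le_power2)
  then have "E * (d\<^sup>2 * E) \<le> E * (k1\<^sup>2 * (L\<^sup>2 + P\<^sup>2))" by (simp add: power2_eq_square mult_ac)
  then have dE: "d\<^sup>2 * E \<le> k1\<^sup>2 * (L\<^sup>2 + P\<^sup>2)"
    using E0 by (cases "E = 0") auto
  have "k1 * (d\<^sup>2 * D) = d\<^sup>2 * (k1 * D)" by simp
  also have "\<dots> \<le> d\<^sup>2 * E" using DE by (intro mult_left_mono) auto
  also have "\<dots> \<le> k1 * (k1 * (L\<^sup>2 + P\<^sup>2))" using dE by (simp add: power2_eq_square)
  finally have "d\<^sup>2 * D \<le> k1 * (L\<^sup>2 + P\<^sup>2)" using k1 by simp
  \<comment> \<open>The factor \<open>k1\<close> left over from the passage through \<open>E\<close>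
    is removed by \<open>k1 \<le> 1\<close>.\<close>
  also have "\<dots> \<le> 1 * (L\<^sup>2 + P\<^sup>2)" using k by (intro mult_right_mono) auto
  finally show ?thesis using d unfolding D_def d_def[symmetric] by (simp add: field_simps)
qed

text \<open>Letters as in \<open>error_bound_on_cone\<close>, with \<open>J\<close> the sorted norm
  of \<open>m\<close>. \<open>RE\<close> is the cross-term condition for the rescaled pair
  \<open>(r b, m)\<close>.\<close>

lemma outside_cone_impossible:
  fixes a w N q J S U rho k2 :: real
  assumes nonneg: "0 \<le> a" "0 \<le> w" "0 \<le> N" "0 \<le> S" and U: "0 < U" and rho: "10 \<le> rho" and k2: "0 < k2" "k2 < 1 / 2"
    and outside: "5 * (U * a + S * w) < J"
    and I: "w\<^sup>2 + q \<le> 2 * rho * (S * w) - rho / 2 * J"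
    and III: "N\<^sup>2 + q \<le> sqrt 5 * U * N"
    and CS: "\<bar>q\<bar> \<le> N * w" and a0: "a = 0 \<Longrightarrow> q = 0"
    and RE: "\<And>r. 0 < r \<Longrightarrow> J \<le> 5 * (U * (r * a) + S * w) \<Longrightarrow> r * \<bar>q\<bar> \<le> k2 * ((r * a)\<^sup>2 + w\<^sup>2)"
  shows False
proof -
  have J: "0 < J" using outside nonneg U by (smt (verit) mult_nonneg_nonneg)
  \<comment> \<open>Being outside the cone bounds \<open>2 * rho * (S * w)\<close> by
    \<open>2 / 5 * rho * J\<close>, so \<open>rho / 10 * J\<close> of the penalty survives.\<close>
  have "rho * (5 * (S * w)) \<le> rho * J" using outside nonneg U rho by (intro mult_left_mono) (smt (verit) mult_nonneg_nonneg)+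
  then have z: "w\<^sup>2 + rho / 10 * J \<le> - q" using I by simp
  have R: "0 < rho / 10 * J" using J rho by simp
  have q: "q < 0" "w\<^sup>2 < - q" using z R zero_le_power2[of w] by linarith+
  then have a: "0 < a" using a0 nonneg by force
  have "0 < N * w" using CS q by linarith
  then have N: "0 < N" and w: "0 < w" using nonneg by (auto simp: zero_less_mult_iff)
  \<comment> \<open>This bound on \<open>N\<close> limits \<open>- q\<close> to
    \<open>sqrt 5 * U * w + w\<^sup>2\<close>; comparison with \<open>z\<close> then bounds
    \<open>J\<close> by \<open>5 * (U * w)\<close>.\<close>
  have "N * N \<le> N * (sqrt 5 * U + w)" using III CS q by (simp add: power2_eq_square algebra_simps)
  then have "N \<le> sqrt 5 * U + w" using N by simp
  then have "N * w \<le> (sqrt 5 * U + w) * w" using w by simp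
  then have "rho / 10 * J \<le> sqrt 5 * U * w" using z CS q by (simp add: power2_eq_square algebra_simps)
  also have "\<dots> \<le> 5 * U * w" using U w by (intro mult_right_mono) (auto simp: real_le_lsqrt)
  finally have "rho * J \<le> 50 * (U * w)" by simp
  moreover have "10 * J \<le> rho * J" using rho J by (intro mult_right_mono) auto
  ultimately have JU: "J \<le> 5 * (U * w)" by simp
  \<comment> \<open>The scaling that reaches the boundary of the cone: \<open>outside\<close> makes
    \<open>r > 1\<close>, and \<open>JU\<close> keeps \<open>r * a \<le> w\<close>.\<close>
  define r where "r = (J - 5 * (S * w)) / (5 * (U * a))"
  have ra: "5 * (U * (r * a)) = J - 5 * (S * w)" using U a by (simp add: r_def)
  have r1: "1 < r" using outside U a by (simp add: r_def field_simps)
  have "U * (r * a) \<le> U * w" using ra JU mult_nonneg_nonneg[OF nonneg(4,2)] by linarith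
  then have "r * a \<le> w" using U by simp
  then have "(r * a)\<^sup>2 \<le> w\<^sup>2" using r1 a by (intro power_mono) auto
  then have "k2 * ((r * a)\<^sup>2 + w\<^sup>2) \<le> k2 * (2 * w\<^sup>2)" using k2 by (intro mult_left_mono) auto
  also have "\<dots> \<le> w\<^sup>2" using mult_right_mono[of "2 * k2" 1 "w\<^sup>2"] k2 by simp
  finally have "r * \<bar>q\<bar> \<le> w\<^sup>2" using RE[of r] ra r1 by simp
  moreover have "1 * \<bar>q\<bar> \<le> r * \<bar>q\<bar>" using r1 by (intro mult_right_mono) auto
  ultimately have "\<bar>q\<bar> \<le> w\<^sup>2" by linarith
  then show False using q by simp
qed

section \<open>Size of the squared weights\<close>

lemma sum_ln_ratio:
  fixes c :: real
  assumes "0 < c"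
  shows "(\<Sum>j=1..s. ln (c / real j)) = real s * ln c - ln (fact s)"
proof (induction s)
  case (Suc s)
  have "ln (fact (Suc s) :: real) = ln (real (Suc s)) + ln (fact s)"
    by (simp add: ln_mult del: of_nat_Suc)
  with Suc assms show ?case by (simp add: ln_div algebra_simps)
qed simp

text \<open>The elementary Stirling bound \<open>ln (fact s) \<ge> s ln s - s\<close>.\<close>

lemma sum_ln_ratio_le:
  fixes c :: real
  assumes "0 < c" "0 < s"
  shows "(\<Sum>j=1..s. ln (c / real j)) \<le> real s * ln (exp 1 * c / real s)"
proof -
  have "ln (real s ^ s) \<le> ln (exp (real s) * fact s)"
    using power_self_le_exp_fact[of s] assms by (subst ln_le_cancel_iff) auto
  then have "real s * ln (real s) \<le> real s + ln (fact s)"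
    using assms by (simp add: ln_realpow ln_mult)
  then show ?thesis unfolding sum_ln_ratio[OF assms(1)] using assms by (simp add: ln_div ln_mult algebra_simps)
qed

section \<open>The estimation bound\<close>

text \<open>The event is fixed before the minimiser is chosen, so the bound holds for all minimisers
  simultaneously and no measurable selection arises.\<close>

theorem theorem2:
  fixes M :: "'w measure"
    and X :: "real ^ 'p ^ 'n"
    and beta_star :: "real ^ 'p"
    and mu_star :: "real ^ 'n"
    and eps :: "'w \<Rightarrow> real ^ 'n"
    and s :: nat
    and sigma rho kappa1 kappa2 :: real
  defines "n \<equiv> CARD('n)"
    and "p \<equiv> CARD('p)"
  defines "lam \<equiv> (\<lambda>i::nat. sigma * sqrt (ln (2 * real n / real i)))"
    and "y \<equiv> (\<lambda>\<omega>. X *v beta_star + mu_star + eps \<omega>)"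
    and "k1 \<equiv> real p / ln 2"
    and "s1 \<equiv> real s * ln (2 * exp 1 * real n / real s) / ln 2"
    and "kappa \<equiv> sqrt (kappa1 - 2 * kappa2)"
  assumes "prob_space M"
    and cols: "\<forall>j. norm (column j X) = 1"
    and s_pos: "0 < s" and s_le: "s \<le> n"
    and sparse: "l0 mu_star \<le> s"
    and sigma_pos: "0 < sigma"
    and noise_dist: "\<forall>i. distributed M lborel (\<lambda>\<omega>. eps \<omega> $ i) (normal_density 0 sigma)"
    and noise_indep: "prob_space.indep_vars M (\<lambda>_. borel) (\<lambda>i \<omega>. eps \<omega> $ i) UNIV"
    and rho: "rho \<ge> 2 * (4 + sqrt 2)"
    and kappas: "kappa1 > 2 * kappa2" "kappa2 > 0"
    and RE: "\<forall>(b :: real ^ 'p) (m :: real ^ 'n).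
               (\<Sum>j=1..n. lam j / lam n * sabs m j)
                 \<le> 5 * (sqrt k1 * norm b + sqrt s1 * norm m) \<longrightarrow>
               (norm (X *v b))\<^sup>2 + (norm m)\<^sup>2 \<ge> kappa1 * ((norm b)\<^sup>2 + (norm m)\<^sup>2) \<and>
               \<bar>inner (X *v b) m\<bar> \<le> kappa2 * ((norm b)\<^sup>2 + (norm m)\<^sup>2)"
  shows "\<exists>A \<in> sets M.
           measure M A \<ge> 1 - (1/2) * (real s / (2 * real n)) ^ s - exp (- real p) \<and>
           (\<forall>\<omega> \<in> A. \<forall>(bh :: real ^ 'p) (mh :: real ^ 'n).
              (\<forall>b m. (norm (y \<omega> - X *v bh - mh))\<^sup>2 + 2 * rho * sorted_l1 lam mh
                      \<le> (norm (y \<omega> - X *v b - m))\<^sup>2 + 2 * rho * sorted_l1 lam m) \<longrightarrow>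
              (norm (bh - beta_star))\<^sup>2 + (norm (mh - mu_star))\<^sup>2
                \<le> 4 * rho\<^sup>2 / kappa ^ 4 * (\<Sum>j=1..s. (lam j)\<^sup>2) + 5 * sigma\<^sup>2 / kappa ^ 4 * real p)
         \<and> 4 * rho\<^sup>2 / kappa ^ 4 * (\<Sum>j=1..s. (lam j)\<^sup>2) + 5 * sigma\<^sup>2 / kappa ^ 4 * real p
             \<le> sigma\<^sup>2 / kappa ^ 4 * (4 * rho\<^sup>2 * real s * ln (2 * exp 1 * real n / real s) + 5 * real p)"
proof -
  interpret gaussian_noise M eps sigma
    unfolding gaussian_noise_def gaussian_noise_axioms_def
    using \<open>prob_space M\<close> sigma_pos noise_dist noise_indep by blast
  \<comment> \<open>\<open>L\<close> enters the final bound; its majorant \<open>S\<close> and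
    \<open>U\<close> are the coefficients of the rescaled cone condition.\<close>
  define L where "L = sqrt (\<Sum>j=1..s. (lam j)\<^sup>2)"
  define S where "S = sigma * sqrt (real s * ln (2 * exp 1 * real n / real s))"
  define U where "U = sigma * sqrt (real p)"
  have n0: "0 < n" and p0: "0 < p" by (auto simp: n_def p_def)
  have U0: "0 < U" using sigma_pos p0 by (simp add: U_def)
  have "1 \<le> sqrt (2 :: real)" by simp
  then have rho10: "10 \<le> rho" using rho by argo
  have lnj: "0 \<le> ln (2 * real n / real j)" if "j \<in> {1..n}" for j
    using that by (intro ln_ge_zero) (auto simp: field_simps)
  have lam0: "0 \<le> lam j" if "j \<in> {1..n}" for j
    using lnj[OF that] sigma_pos by (simp add: lam_def)
  have lam_mono: "antimono_on {1..n} lam"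
    unfolding lam_def using sigma_pos
    by (intro monotone_onI mult_left_mono real_sqrt_le_mono) (auto intro!: divide_left_mono)
  have lam2: "(lam j)\<^sup>2 = sigma\<^sup>2 * ln (2 * real n / real j)" if "j \<in> {1..n}" for j
    using lnj[OF that] by (simp add: lam_def power_mult_distrib)
  have lamn: "lam n = sigma * sqrt (ln 2)" using n0 by (simp add: lam_def)
  have lamn0: "0 < lam n" using sigma_pos by (simp add: lamn)
  have "(\<Sum>j=1..s. (lam j)\<^sup>2) = sigma\<^sup>2 * (\<Sum>j=1..s. ln (2 * real n / real j))"
    unfolding sum_distrib_left using s_le by (intro sum.cong lam2) auto
  also have "\<dots> \<le> sigma\<^sup>2 * (real s * ln (exp 1 * (2 * real n) / real s))"
    using n0 s_pos by (intro mult_left_mono sum_ln_ratio_le) auto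
  finally have sum_lam: "(\<Sum>j=1..s. (lam j)\<^sup>2) \<le> sigma\<^sup>2 * (real s * ln (2 * exp 1 * real n / real s))"
    by (simp add: mult_ac)
  have "L \<le> sqrt (sigma\<^sup>2 * (real s * ln (2 * exp 1 * real n / real s)))"
    unfolding L_def by (rule real_sqrt_le_mono[OF sum_lam])
  then have LS: "L \<le> S" using sigma_pos by (simp add: S_def real_sqrt_mult)
  have L0: "0 \<le> L" by (simp add: L_def sum_nonneg)
  \<comment> \<open>Multiplying by \<open>lam n\<close> clears the normalisation: its
    \<open>ln 2\<close> cancels those in \<open>k1\<close> and \<open>s1\<close>.\<close>
  have cone: "(\<Sum>j=1..n. lam j / lam n * sabs m j) \<le> 5 * (sqrt k1 * norm b + sqrt s1 * norm m)
      \<longleftrightarrow> sorted_l1 lam m \<le> 5 * (U * norm b + S * norm m)" for b :: "real ^ 'p" and m :: "real ^ 'n"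
  proof -
    have "(\<Sum>j=1..n. lam j / lam n * sabs m j) = sorted_l1 lam m / lam n"
      by (simp add: sorted_l1_def n_def sum_divide_distrib)
    moreover have "lam n * sqrt k1 = U" by (simp add: lamn k1_def U_def real_sqrt_divide)
    moreover have "lam n * sqrt s1 = S" by (simp add: lamn s1_def S_def real_sqrt_divide)
    moreover have "lam n * (5 * (sqrt k1 * norm b + sqrt s1 * norm m))
        = 5 * ((lam n * sqrt k1) * norm b + (lam n * sqrt s1) * norm m)" by (simp add: algebra_simps)
    ultimately show ?thesis using lamn0 by (simp add: pos_divide_le_eq mult.commute)
  qed
  have RE': "kappa1 * ((norm b)\<^sup>2 + (norm m)\<^sup>2) \<le> (norm (X *v b))\<^sup>2 + (norm m)\<^sup>2"
      "\<bar>inner (X *v b) m\<bar> \<le> kappa2 * ((norm b)\<^sup>2 + (norm m)\<^sup>2)"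
    if "sorted_l1 lam m \<le> 5 * (U * norm b + S * norm m)" for b :: "real ^ 'p" and m :: "real ^ 'n"
    using RE that unfolding cone by blast+
  have kappa1_le: "kappa1 \<le> 1"
  proof -
    \<comment> \<open>Test with \<open>m = 0\<close> and a coordinate vector \<open>b\<close>: the
      pair lies in the cone, and \<open>X\<close> maps \<open>b\<close> to a unit column.\<close>
    fix j :: 'p
    have "sabs (0 :: real ^ 'n) i = 0" if "i \<in> {1..n}" for i
      using sabs_eq_0_of_sparse[of "0 :: real ^ 'n" 0 i] that by (simp add: l0_def n_def)
    then have "sorted_l1 lam (0 :: real ^ 'n) = 0" by (auto simp: sorted_l1_def n_def intro!: sum.neutral)
    then show ?thesis
      using RE'(1)[of 0 "axis j 1"] U0 cols by (simp add: matrix_vector_mult_basis norm_axis_1)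
  qed
  have kappa4: "kappa ^ 4 = (kappa1 - 2 * kappa2)\<^sup>2"
  proof -
    have "kappa ^ 4 = (kappa\<^sup>2)\<^sup>2" by simp
    then show ?thesis using kappas by (simp add: kappa_def)
  qed
  obtain A1 where A1: "A1 \<in> events" "1 - exp (- real p) \<le> prob A1"
      "\<And>\<omega> b. \<omega> \<in> A1 \<Longrightarrow> inner (eps \<omega>) (X *v b) \<le> sigma * sqrt (5 * real p) * norm (X *v b)"
    using prob_inner_range_le[of X] unfolding p_def by blast
  obtain A2 where A2: "A2 \<in> events" "1 - 1 / 2 * (real s / (2 * real n)) ^ s \<le> prob A2"
      "\<And>\<omega> T. \<omega> \<in> A2 \<Longrightarrow> s \<le> card T \<Longrightarrow>
         (\<Sum>i\<in>T. (eps \<omega> $ i)\<^sup>2) \<le> 25 * (sigma\<^sup>2 * (real (card T) * ln (2 * real n / real (card T))))"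
    using prob_sum_squares_le[OF s_pos s_le[unfolded n_def]] unfolding n_def by blast
  have energy: "(\<Sum>i\<in>T. (eps \<omega> $ i)\<^sup>2) \<le> 5\<^sup>2 * (real (card T) * (lam (card T))\<^sup>2)"
    if "\<omega> \<in> A2" "s \<le> card T" for \<omega> T
  proof -
    have "card T \<in> {1..n}" using that(2) s_pos card_mono[of UNIV T] by (auto simp: n_def)
    then show ?thesis using A2(3)[OF that] by (simp add: lam2 mult_ac)
  qed
  have bound: "(norm (bh - beta_star))\<^sup>2 + (norm (mh - mu_star))\<^sup>2
      \<le> 4 * rho\<^sup>2 / kappa ^ 4 * (\<Sum>j=1..s. (lam j)\<^sup>2) + 5 * sigma\<^sup>2 / kappa ^ 4 * real p"
    if \<omega>: "\<omega> \<in> A1 \<inter> A2"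
      and opt: "\<And>b m. (norm (y \<omega> - X *v bh - mh))\<^sup>2 + 2 * rho * sorted_l1 lam mh
                      \<le> (norm (y \<omega> - X *v b - m))\<^sup>2 + 2 * rho * sorted_l1 lam m"
    for \<omega> and bh :: "real ^ 'p" and mh :: "real ^ 'n"
  proof -
    define b where "b = bh - beta_star"
    define m where "m = mh - mu_star"
    let ?q = "inner (X *v b) m" and ?J = "sorted_l1 lam m"
    let ?tail = "\<Sum>j=Suc s..n. lam j * sabs m j" and ?head = "\<Sum>j=1..s. lam j * sabs m j"
    have r: "y \<omega> - X *v bh - mh = eps \<omega> - X *v b - m"
      by (simp add: y_def b_def m_def matrix_vector_mult_diff_distrib)
    note fo = slope_first_order[OF lam_mono[unfolded n_def] lam0[unfolded n_def] _ opt, unfolded r]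
    have III: "(norm (X *v b))\<^sup>2 + ?q \<le> sqrt 5 * U * norm (X *v b)"
    proof -
      \<comment> \<open>With \<open>mh\<close> as end point the penalty terms cancel.\<close>
      have "- inner (eps \<omega> - X *v b - m) (X *v b) \<le> 0"
        using fo[of beta_star mh] rho10 by (simp add: b_def)
      then have "(norm (X *v b))\<^sup>2 + ?q \<le> inner (eps \<omega>) (X *v b)"
        by (simp add: inner_diff_left power2_norm_eq_inner inner_commute[of m])
      also have "\<dots> \<le> sqrt 5 * U * norm (X *v b)"
        using A1(3)[of \<omega> b] \<omega> by (simp add: U_def real_sqrt_mult mult_ac)
      finally show ?thesis .
    qed
    have J: "?J = ?head + ?tail"
      using sum.ub_add_nat[of 1 s "\<lambda>j. lam j * sabs m j" "n - s"] s_le by (simp add: sorted_l1_def n_def)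
    have head: "?head \<le> L * norm m" unfolding L_def using s_le by (intro sum_mult_sabs_le_L2) (simp add: n_def)
    have tail0: "0 \<le> ?tail"
      by (intro sum_nonneg mult_nonneg_nonneg lam0 sabs_nonneg) (auto simp: n_def)
    have I: "(norm m)\<^sup>2 + ?q \<le> 2 * rho * (L * norm m) - rho / 2 * ?J"
    proof -
      have "- inner (eps \<omega> - X *v b - m) m \<le> rho * (sorted_l1 lam mu_star - sorted_l1 lam mh)"
        using fo[of bh mu_star] rho10 by (simp add: m_def)
      then have "(norm m)\<^sup>2 + ?q \<le> inner (eps \<omega>) m + rho * (sorted_l1 lam mu_star - sorted_l1 lam mh)"
        by (simp add: inner_diff_left power2_norm_eq_inner)
      also have "sorted_l1 lam mu_star - sorted_l1 lam mh \<le> ?head - ?tail"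
        using sorted_l1_sparse_diff[OF lam_mono[unfolded n_def] lam0[unfolded n_def] sparse s_le[unfolded n_def], of m]
        by (simp add: m_def n_def)
      \<comment> \<open>The constant 5 is the square root of the energy constant 25.\<close>
      also have "inner (eps \<omega>) m \<le> 5 * (L * norm m) + 5 * ?tail"
        unfolding L_def n_def using \<omega> energy s_pos s_le lam_mono lam0
        by (intro inner_le_of_subset_energy) (auto simp: n_def)
      finally have *: "(norm m)\<^sup>2 + ?q \<le> 5 * (L * norm m) + 5 * ?tail + rho * (?head - ?tail)"
        using rho10 by simp
      \<comment> \<open>As \<open>5 \<le> rho / 2\<close>, half of the penalty absorbs the noise on
        the tail; the head then costs \<open>rho / 2 + 3 / 2 * rho = 2 * rho\<close> times
        \<open>L * norm m\<close>.\<close>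
      have "5 * (L * norm m) \<le> rho / 2 * (L * norm m)" "5 * ?tail \<le> rho / 2 * ?tail"
        using rho10 tail0 L0 by (intro mult_right_mono; simp)+
      moreover have "rho * ?head \<le> rho * (L * norm m)" using head rho10 by (intro mult_left_mono) auto
      ultimately show ?thesis using * unfolding J by (simp add: algebra_simps)
    qed
    have J0: "0 \<le> ?J" unfolding sorted_l1_def using lam0
      by (intro sum_nonneg mult_nonneg_nonneg sabs_nonneg) (auto simp: n_def)
    have in_cone: "?J \<le> 5 * (U * norm b + S * norm m)"
    proof (rule ccontr)
      assume "\<not> ?thesis"
      then have out: "5 * (U * norm b + S * norm m) < ?J" by simp
      show False
      proof (rule outside_cone_impossible[OF _ _ _ _ U0 rho10 kappas(2) _ out _ III])
        have "2 * rho * (L * norm m) \<le> 2 * rho * (S * norm m)"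
          using LS rho10 by (intro mult_left_mono mult_right_mono) auto
        then show "(norm m)\<^sup>2 + ?q \<le> 2 * rho * (S * norm m) - rho / 2 * ?J" using I by simp
        show "\<bar>?q\<bar> \<le> norm (X *v b) * norm m" by (rule Cauchy_Schwarz_ineq2)
        show "?q = 0" if "norm b = 0" using that by simp
        show "r * \<bar>?q\<bar> \<le> kappa2 * ((r * norm b)\<^sup>2 + (norm m)\<^sup>2)"
          if "0 < r" "?J \<le> 5 * (U * (r * norm b) + S * norm m)" for r
          using RE'(2)[of m "r *\<^sub>R b"] that by (simp add: matrix_vector_mult_scaleR abs_mult)
      qed (use kappas kappa1_le L0 LS in auto)
    qed
    \<comment> \<open>Adding \<open>I\<close> and \<open>III\<close> doubles the cross term, and the
      remaining penalty is dropped. Using \<open>L\<close> rather than \<open>S\<close> keeps the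
      exact sum of squared weights.\<close>
    have "(norm b)\<^sup>2 + (norm m)\<^sup>2 \<le> ((2 * rho * L)\<^sup>2 + (sqrt 5 * U)\<^sup>2) / (kappa1 - 2 * kappa2)\<^sup>2"
    proof (rule error_bound_on_cone[OF _ RE'[OF in_cone] kappas kappa1_le])
      have "0 \<le> rho / 2 * ?J" using J0 rho10 by simp
      then show "(norm m)\<^sup>2 + (norm (X *v b))\<^sup>2 + 2 * ?q \<le> sqrt 5 * U * norm (X *v b) + 2 * rho * L * norm m"
        using I III by (simp add: mult.assoc)
    qed
    also have "\<dots> = 4 * rho\<^sup>2 / kappa ^ 4 * (\<Sum>j=1..s. (lam j)\<^sup>2) + 5 * sigma\<^sup>2 / kappa ^ 4 * real p"
    proof -
      have "(2 * rho * L)\<^sup>2 = 4 * rho\<^sup>2 * (\<Sum>j=1..s. (lam j)\<^sup>2)"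
        by (simp add: L_def power_mult_distrib sum_nonneg)
      moreover have "(sqrt 5 * U)\<^sup>2 = 5 * sigma\<^sup>2 * real p" by (simp add: U_def power_mult_distrib)
      ultimately show ?thesis unfolding kappa4 by (simp only: add_divide_distrib times_divide_eq_left)
    qed
    finally show ?thesis by (simp add: b_def m_def)
  qed
  have "prob (space M - A1 \<inter> A2) \<le> prob (space M - A1) + prob (space M - A2)"
    unfolding Diff_Int using A1(1) A2(1) by (intro measure_Un_le) auto
  then have "1 - (1/2) * (real s / (2 * real n)) ^ s - exp (- real p) \<le> prob (A1 \<inter> A2)"
    using prob_compl[OF A1(1)] prob_compl[OF A2(1)] prob_compl[of "A1 \<inter> A2"] A1(1,2) A2(1,2) by simp
  moreover have "4 * rho\<^sup>2 / kappa ^ 4 * (\<Sum>j=1..s. (lam j)\<^sup>2) + 5 * sigma\<^sup>2 / kappa ^ 4 * real p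
             \<le> sigma\<^sup>2 / kappa ^ 4 * (4 * rho\<^sup>2 * real s * ln (2 * exp 1 * real n / real s) + 5 * real p)"
  proof -
    have "4 * rho\<^sup>2 / kappa ^ 4 * (\<Sum>j=1..s. (lam j)\<^sup>2)
        \<le> 4 * rho\<^sup>2 / kappa ^ 4 * (sigma\<^sup>2 * (real s * ln (2 * exp 1 * real n / real s)))"
      by (intro mult_left_mono sum_lam) (simp add: kappa4)
    then show ?thesis by (simp add: distrib_left mult_ac)
  qed
  ultimately show ?thesis using A1(1) A2(1) bound by blast
qed

end
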